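(* Let $n\ge 1$, let $h_0,h_1,\dots,h_n$ be positive integers, and let $f_{\bm\theta}:\mathbb{R}^{h_0}\to\mathbb{R}^{h_n}$ be an $n$-layer fully connected feed-forward neural network with layer sizes $h_0,\dots,h_n$ whose activation functions are all $1$-Lipschitz. Suppose that all entries of the weight matrices $\bm\theta_1,\dots,\bm\theta_n$ are independent Gaussian random variables, the entries of the $j$-th weight matrix $\bm\theta_j$ being distributed as $\mathcal{N}(0,\sigma_{\bm\theta_j}^2)$ for $j=1,\dots,n$. Then the expected Lipschitz constant of $f_{\bm\theta}$ satisfies $$\mathbb{E}\big[L(f_{\bm\theta})\big]\;\le\;\prod_{j=1}^{n}\left(\sqrt{h_{j-1}}+\sqrt{h_j}\right)\cdot\sigma_{\bm\theta_j}.$$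
   Context: An $n$-layer fully connected feed-forward network with layer sizes $h_0,\dots,h_n$ is a map $f_{\bm\theta}=\phi_n\circ A_n\circ\cdots\circ\phi_1\circ A_1$, where $A_j:\mathbb{R}^{h_{j-1}}\to\mathbb{R}^{h_j}$ is the affine map $A_j(\bm z)=\bm\theta_j^{\top}\bm z+\bm b_j$ with weight matrix $\bm\theta_j\in\mathbb{R}^{h_{j-1}\times h_j}$ and a fixed (deterministic) bias vector $\bm b_j$, and $\phi_j$ applies a scalar $1$-Lipschitz activation function to each coordinate (e.g. ReLU; the identity is allowed). Here $h_0$ is the input dimension and $h_j$ is the size (width) of layer $j$. The number $\sigma_{\bm\theta_j}\ge 0$ is the standard deviation of the weights of layer $j$. The Lipschitz constant $L(f)$ is the smallest $L\ge 0$ with $\|f(\bm x)-f(\bm x')\|_2\le L\|\bm x-\bm x'\|_2$ for all inputs $\bm x,\bm x'$, where $\|\cdot\|_2$ is the Euclidean norm. The expectation is over the random weights. *)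

theory Defs
  imports "HOL-Probability.Probability" "Jordan_Normal_Form.Matrix"
begin

type_synonym rvec = "real Matrix.vec"
type_synonym rmat = "real Matrix.mat"

definition vec_norm2 :: "rvec \<Rightarrow> real" where
  "vec_norm2 x = L2_set (\<lambda>i. vec_index x i) {..<dim_vec x}"

text \<open>
  The weight matrix of a layer with d inputs and d' outputs is a d by d' matrix,
  so it enters the affine map through its transpose.
\<close>

definition affine_layer :: "rmat \<Rightarrow> rvec \<Rightarrow> rvec \<Rightarrow> rvec" where
  "affine_layer W c z = transpose_mat W *\<^sub>v z + c"

text \<open>Layers are numbered from 1; the values of the parameters at index 0 are irrelevant.\<close>

primrec network ::
  "(nat \<Rightarrow> real \<Rightarrow> real) \<Rightarrow> (nat \<Rightarrow> rmat) \<Rightarrow> (nat \<Rightarrow> rvec) \<Rightarrow> nat \<Rightarrow> rvec \<Rightarrow> rvec" where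
  "network \<phi> W b 0 = (\<lambda>x. x)"
| "network \<phi> W b (Suc j) =
     map_vec (\<phi> (Suc j)) \<circ> affine_layer (W (Suc j)) (b (Suc j)) \<circ> network \<phi> W b j"

text \<open>
  The first argument is the input dimension. The value is unspecified if the map is not
  Lipschitz on that space; if it is, the minimum exists, since the set of admissible
  constants is a nonempty closed subset of the nonnegative reals.
\<close>

definition lipschitz_const :: "nat \<Rightarrow> (rvec \<Rightarrow> rvec) \<Rightarrow> real" where
  "lipschitz_const d f =
     (LEAST L. 0 \<le> L \<and>
        (\<forall>x\<in>carrier_vec d. \<forall>x'\<in>carrier_vec d. vec_norm2 (f x - f x') \<le> L * vec_norm2 (x - x')))"

text \<open>
  A variance of 0 is allowed and gives the point mass at the mean; this case has to be
  separated because \<^const>\<open>normal_density\<close> with deviation 0 is the zero function.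
\<close>

definition gaussian_measure :: "real \<Rightarrow> real \<Rightarrow> real measure" where
  "gaussian_measure \<mu> \<sigma> =
     (if \<sigma> = 0 then return borel \<mu> else density lborel (normal_density \<mu> \<sigma>))"

definition gaussian_rv :: "'a measure \<Rightarrow> ('a \<Rightarrow> real) \<Rightarrow> real \<Rightarrow> real \<Rightarrow> bool" where
  "gaussian_rv M X \<mu> \<sigma> \<longleftrightarrow>
     X \<in> borel_measurable M \<and> distr M borel X = gaussian_measure \<mu> \<sigma>"

end

theory Submission
  imports Defs
begin

text \<open>
  A network is Lipschitz with constant the product of the operator norms of its weight matrices,
  and these norms are independent, so it suffices to bound the expected norm of one Gaussian
  matrix A by \<open>\<sigma> (sqrt m + sqrt n)\<close> (Chevet, Gordon). The norm is the supremum of the Gaussian process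
  \<open>\<langle>A, u \<otimes> v\<rangle>\<close> over unit vectors u, v, whose increments are dominated by those of
  \<open>\<langle>g, u\<rangle> + \<langle>g', v\<rangle>\<close> with independent Gaussian vectors g, g'; the supremum of the latter is
  \<open>norm g + norm g'\<close>. The comparison of the two suprema is the Sudakov--Fernique inequality, proved by
  rotating one process into the other and differentiating the expected log-sum-exp.
\<close>

subsection \<open>Gaussian integration by parts\<close>

text \<open>Both processes are realised as linear forms in the coordinates of a single Gaussian
  product measure. Independence of the two then becomes disjointness of the supports of their
  coefficients, and the rotation acts on coefficients only, so integration by parts in single
  coordinates is enough. The comparison is carried out for finite index sets. Log-sum-exp exceeds
  the maximum by at most the logarithm of the number of points; scaling the process by a large
  factor makes this error negligible, so the bound is independent of that number and survives the
  limit to a countable set of directions. Measurability shapes the rest: the operator norm and the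
  Lipschitz constant are extremal values over uncountable sets, and both are reduced to rational
  points by continuity. The square roots come from bounding the mean norm of a Gaussian vector by
  the root of its mean square.\<close>

lemma prob_space_gaussian_measure: "\<sigma> \<ge> 0 \<Longrightarrow> prob_space (gaussian_measure \<mu> \<sigma>)"
  unfolding gaussian_measure_def
  by (auto intro: prob_space_return prob_space_normal_density)

lemma sets_gaussian_measure [measurable_cong, simp]: "sets (gaussian_measure \<mu> \<sigma>) = sets borel"
  by (simp add: gaussian_measure_def)

lemma space_gaussian_measure [simp]: "space (gaussian_measure \<mu> \<sigma>) = UNIV"
  by (simp add: gaussian_measure_def)

lemma gaussian_measure_second_moment:
  assumes "\<sigma> \<ge> 0"
  shows "integrable (gaussian_measure 0 \<sigma>) (\<lambda>x. x\<^sup>2)" "(\<integral>x. x\<^sup>2 \<partial>gaussian_measure 0 \<sigma>) = \<sigma>\<^sup>2"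
proof -
  have "integrable (gaussian_measure 0 \<sigma>) (\<lambda>x. x\<^sup>2) \<and> (\<integral>x. x\<^sup>2 \<partial>gaussian_measure 0 \<sigma>) = \<sigma>\<^sup>2"
  proof (cases "\<sigma> = 0")
    case True
    then show ?thesis
      by (auto simp: gaussian_measure_def integral_return integrable_iff_bounded nn_integral_return)
  next
    case False
    then have "\<sigma> > 0" using assms by simp
    then show ?thesis
      using integrable_normal_moment[of \<sigma> 0 2] integral_normal_moment_even[of \<sigma> 0 1]
      by (simp add: gaussian_measure_def integrable_density integral_density fact_numeral)
  qed
  then show "integrable (gaussian_measure 0 \<sigma>) (\<lambda>x. x\<^sup>2)" "(\<integral>x. x\<^sup>2 \<partial>gaussian_measure 0 \<sigma>) = \<sigma>\<^sup>2"
    by auto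
qed

lemma gaussian_measure_abs_integrable:
  assumes "\<sigma> \<ge> 0"
  shows "integrable (gaussian_measure 0 \<sigma>) (\<lambda>x. \<bar>x\<bar>)"
proof -
  interpret prob_space "gaussian_measure 0 \<sigma>" by (rule prob_space_gaussian_measure[OF assms])
  have le: "\<bar>x\<bar> \<le> 1 + x\<^sup>2" for x :: real
    using zero_le_power2[of "\<bar>x\<bar> - 1"] by (simp add: power2_diff)
  show ?thesis
    by (rule Bochner_Integration.integrable_bound[of _ "\<lambda>x. 1 + x\<^sup>2"])
       (use gaussian_measure_second_moment[OF assms] le in \<open>auto intro: order_trans[OF _ abs_ge_self]\<close>)
qed

lemma normal_density_has_real_derivative:
  assumes "\<sigma> > 0"
  shows "(normal_density 0 \<sigma> has_real_derivative - (x / \<sigma>\<^sup>2) * normal_density 0 \<sigma> x) (at x)"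
proof -
  have "((\<lambda>x. 1 / sqrt (2 * pi * \<sigma>\<^sup>2) * exp (- (x - 0)\<^sup>2 / (2 * \<sigma>\<^sup>2))) has_real_derivative
      - (x / \<sigma>\<^sup>2) * (1 / sqrt (2 * pi * \<sigma>\<^sup>2) * exp (- (x - 0)\<^sup>2 / (2 * \<sigma>\<^sup>2)))) (at x)"
    using assms by (auto intro!: derivative_eq_intros simp: field_simps)
  then show ?thesis
    unfolding normal_density_def by simp
qed

lemma normal_density_tendsto_0:
  assumes "\<sigma> > 0"
  shows "(normal_density 0 \<sigma> \<longlongrightarrow> 0) at_top" "(normal_density 0 \<sigma> \<longlongrightarrow> 0) at_bot"
proof -
  show 1: "(normal_density 0 \<sigma> \<longlongrightarrow> 0) at_top"
    unfolding normal_density_def using assms by real_asymp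
  show 2: "(normal_density 0 \<sigma> \<longlongrightarrow> 0) at_bot"
    unfolding normal_density_def using assms by real_asymp
qed

text \<open>Stein's identity. The density \<open>d\<close> satisfies
  \<open>d' x = - (x / \<sigma>\<^sup>2) * d x\<close>, so the two integrands are, up to the factor
  \<open>\<sigma>\<^sup>2\<close>, the two halves of the derivative of \<open>f * d\<close>, whose
  integral over the line is 0.\<close>

lemma gaussian_integration_by_parts:
  fixes f f' :: "real \<Rightarrow> real"
  assumes \<sigma>: "\<sigma> \<ge> 0"
    and f: "\<And>x. (f has_real_derivative f' x) (at x)" and cont: "continuous_on UNIV f'"
    and bound: "\<And>x. \<bar>f x\<bar> \<le> C" "\<And>x. \<bar>f' x\<bar> \<le> C'"
  shows "(\<integral>x. x * f x \<partial>gaussian_measure 0 \<sigma>) = \<sigma>\<^sup>2 * (\<integral>x. f' x \<partial>gaussian_measure 0 \<sigma>)"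
proof (cases "\<sigma> = 0")
  \<comment> \<open>The measure is the point mass at 0, so both sides are 0.\<close>
  case True
  then show ?thesis
    using borel_measurable_continuous_onI[OF DERIV_continuous_on[OF has_field_derivative_at_within[OF f]]]
    by (simp add: gaussian_measure_def integral_return)
next
  case False
  with \<sigma> have \<sigma>: "\<sigma> > 0" by simp
  let ?d = "normal_density 0 \<sigma>"
  have [measurable]: "f' \<in> borel_measurable borel"
    by (rule borel_measurable_continuous_onI[OF cont])
  have contf: "continuous_on UNIV f"
    using f by (auto intro!: DERIV_continuous_on)
  then have [measurable]: "f \<in> borel_measurable borel"
    by (rule borel_measurable_continuous_onI)
  have int1: "integrable lborel (\<lambda>x. ?d x * (x * f x))"
  proof (rule Bochner_Integration.integrable_bound[of _ "\<lambda>x. C * (?d x * \<bar>x\<bar>)"])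
    show "integrable lborel (\<lambda>x. C * (?d x * \<bar>x\<bar>))"
      using integrable_normal_moment_abs[of \<sigma> 0 1] \<sigma> by simp
    show "AE x in lborel. norm (?d x * (x * f x)) \<le> norm (C * (?d x * \<bar>x\<bar>))"
    proof (rule AE_I2)
      fix x
      have "\<bar>f x\<bar> * (?d x * \<bar>x\<bar>) \<le> \<bar>C\<bar> * (?d x * \<bar>x\<bar>)"
        using bound(1)[of x] by (intro mult_right_mono) auto
      then show "norm (?d x * (x * f x)) \<le> norm (C * (?d x * \<bar>x\<bar>))"
        by (simp add: abs_mult mult_ac)
    qed
  qed simp
  have int2: "integrable lborel (\<lambda>x. ?d x * f' x)"
  proof (rule Bochner_Integration.integrable_bound[of _ "\<lambda>x. C' * ?d x"])
    show "integrable lborel (\<lambda>x. C' * ?d x)" using \<sigma> by simp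
    show "AE x in lborel. norm (?d x * f' x) \<le> norm (C' * ?d x)"
    proof (rule AE_I2)
      fix x
      have "\<bar>f' x\<bar> * ?d x \<le> \<bar>C'\<bar> * ?d x"
        using bound(2)[of x] by (intro mult_right_mono) auto
      then show "norm (?d x * f' x) \<le> norm (C' * ?d x)"
        by (simp add: abs_mult mult_ac)
    qed
  qed simp
  let ?F = "\<lambda>x. f x * ?d x" and ?F' = "\<lambda>x. ?d x * f' x - (?d x * (x * f x)) / \<sigma>\<^sup>2"
  have intF': "integrable lborel ?F'"
    using int1 int2 by auto
  have contd: "continuous_on UNIV ?d"
    using normal_density_has_real_derivative[OF \<sigma>] by (auto intro!: DERIV_continuous_on)
  \<comment> \<open>No boundary terms remain: \<open>f\<close> is bounded and the density vanishes
    at both ends.\<close>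
  have lim: "(?F \<longlongrightarrow> 0) G" if d: "(?d \<longlongrightarrow> 0) G" for G
  proof (rule tendsto_0_le[OF d, of _ "\<bar>C\<bar>"], rule always_eventually, rule allI)
    fix x
    have "\<bar>f x\<bar> * ?d x \<le> \<bar>C\<bar> * ?d x"
      using bound(1)[of x] by (intro mult_right_mono) auto
    then show "norm (?F x) \<le> norm (?d x) * \<bar>C\<bar>"
      by (simp add: abs_mult mult_ac)
  qed
  have "(LBINT x=-\<infinity>..\<infinity>. ?F' x) = 0 - 0"
  proof (rule interval_integral_FTC_integrable[of _ _ ?F])
    fix x
    show "(?F has_vector_derivative ?F' x) (at x)"
      unfolding has_real_derivative_iff_has_vector_derivative[symmetric]
      by (rule derivative_eq_intros f normal_density_has_real_derivative \<sigma> refl)+ (simp add: field_simps)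
    show "isCont ?F' x"
      using cont contf contd \<sigma> unfolding continuous_on_eq_continuous_at[OF open_UNIV]
      by (auto intro!: continuous_intros)
  next
    show "set_integrable lborel (einterval (-\<infinity>) \<infinity>) ?F'"
      using intF' by (simp add: set_integrable_def)
    show "((?F \<circ> real_of_ereal) \<longlongrightarrow> 0) (at_right (-\<infinity>))" "((?F \<circ> real_of_ereal) \<longlongrightarrow> 0) (at_left \<infinity>)"
      using lim[OF normal_density_tendsto_0(1)[OF \<sigma>]] lim[OF normal_density_tendsto_0(2)[OF \<sigma>]]
      by (simp_all add: ereal_tendsto_simps)
  qed simp
  then have "(\<integral>x. ?F' x \<partial>lborel) = 0"
    by (simp add: interval_lebesgue_integral_def set_lebesgue_integral_def)
  then have "(\<integral>x. ?d x * f' x \<partial>lborel) = (\<integral>x. ?d x * (x * f x) \<partial>lborel) / \<sigma>\<^sup>2"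
    using int1 int2 by simp
  then show ?thesis
    using \<sigma> by (simp add: gaussian_measure_def integral_density field_simps)
qed

text \<open>Differentiation under the integral sign. Limits are taken along sequences because
  dominated convergence is a statement about sequences.\<close>

lemma has_real_derivative_integral:
  fixes f f' :: "real \<Rightarrow> 'a \<Rightarrow> real"
  assumes int: "\<And>t. integrable M (f t)" and meas: "\<And>t. f' t \<in> borel_measurable M"
    and deriv: "\<And>t x. x \<in> space M \<Longrightarrow> ((\<lambda>t. f t x) has_real_derivative f' t x) (at t)"
    and bound: "\<And>t x. x \<in> space M \<Longrightarrow> \<bar>f' t x\<bar> \<le> g x" and g: "integrable M g"
  shows "((\<lambda>t. \<integral>x. f t x \<partial>M) has_real_derivative (\<integral>x. f' t x \<partial>M)) (at t)"
  unfolding DERIV_def tendsto_at_iff_sequentially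
proof (intro allI impI)
  fix X :: "nat \<Rightarrow> real"
  assume X: "\<forall>i. X i \<in> UNIV - {0}" "X \<longlonglongrightarrow> 0"
  have "(\<lambda>i. \<integral>x. (f (t + X i) x - f t x) / X i \<partial>M) \<longlonglongrightarrow> (\<integral>x. f' t x \<partial>M)"
  proof (rule integral_dominated_convergence[OF meas _ g])
    show "(\<lambda>x. (f (t + X i) x - f t x) / X i) \<in> borel_measurable M" for i
      using int by (intro borel_measurable_divide borel_measurable_diff) auto
    show "AE x in M. (\<lambda>i. (f (t + X i) x - f t x) / X i) \<longlonglongrightarrow> f' t x"
    proof (rule AE_I2)
      fix x assume "x \<in> space M"
      from deriv[OF this, of t] show "(\<lambda>i. (f (t + X i) x - f t x) / X i) \<longlonglongrightarrow> f' t x"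
        using X unfolding DERIV_def tendsto_at_iff_sequentially by (auto simp: comp_def)
    qed
    show "AE x in M. norm ((f (t + X i) x - f t x) / X i) \<le> g x" for i
    proof (rule AE_I2)
      fix x assume x: "x \<in> space M"
      \<comment> \<open>The mean value inequality turns the bound on \<open>f'\<close>, uniform in
        \<open>t\<close>, into a bound on every difference quotient.\<close>
      have "norm (f (t + X i) x - f t x) \<le> g x * norm (t + X i - t)"
        by (rule field_differentiable_bound[of UNIV _ "\<lambda>t. f' t x"])
           (use deriv[OF x] bound[OF x] in \<open>auto simp: has_field_derivative_at_within\<close>)
      then show "norm ((f (t + X i) x - f t x) / X i) \<le> g x"
        using X(1) by (simp add: field_simps)
    qed
  qed
  then show "((\<lambda>h. ((\<integral>x. f (t + h) x \<partial>M) - (\<integral>x. f t x \<partial>M)) / h) \<circ> X) \<longlonglongrightarrow> (\<integral>x. f' t x \<partial>M)"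
    using int by (simp add: comp_def)
qed

section \<open>Finite products of centred Gaussian measures\<close>

lemma product_prob_space_gaussian:
  assumes "\<sigma> \<ge> 0"
  shows "product_prob_space (\<lambda>_. gaussian_measure 0 \<sigma>)"
  using prob_space_gaussian_measure[OF assms]
  by (intro product_prob_spaceI) auto

lemma PiM_gaussian_coordinate_distr:
  assumes "\<sigma> \<ge> 0" "k \<in> I"
  shows "distr (PiM I (\<lambda>_. gaussian_measure 0 \<sigma>)) borel (\<lambda>z. z k) = gaussian_measure 0 \<sigma>"
  using distr_PiM_component[of I "\<lambda>_. gaussian_measure 0 \<sigma>" k] prob_space_gaussian_measure[of \<sigma> 0] assms
  by (subst distr_cong[of _ _ _ "gaussian_measure 0 \<sigma>" _ "\<lambda>z. z k"]) auto

lemma PiM_gaussian_coordinate_measurable: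
  assumes "k \<in> I"
  shows "(\<lambda>z. z k) \<in> borel_measurable (PiM I (\<lambda>_. gaussian_measure 0 \<sigma>))"
  using measurable_component_singleton[OF assms, of "\<lambda>_. gaussian_measure 0 \<sigma>"]
  by (simp add: measurable_cong_sets[OF refl sets_gaussian_measure])

lemma PiM_gaussian_coordinate_moments:
  assumes "\<sigma> \<ge> 0" "k \<in> I"
  shows "integrable (PiM I (\<lambda>_. gaussian_measure 0 \<sigma>)) (\<lambda>z. \<bar>z k\<bar>)"
    "integrable (PiM I (\<lambda>_. gaussian_measure 0 \<sigma>)) (\<lambda>z. (z k)\<^sup>2)"
    "(\<integral>z. (z k)\<^sup>2 \<partial>PiM I (\<lambda>_. gaussian_measure 0 \<sigma>)) = \<sigma>\<^sup>2"
proof -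
  let ?P = "PiM I (\<lambda>_. gaussian_measure 0 \<sigma>)"
  note m = PiM_gaussian_coordinate_measurable[OF assms(2), of \<sigma>]
  note d = PiM_gaussian_coordinate_distr[OF assms]
  show "integrable ?P (\<lambda>z. \<bar>z k\<bar>)"
    using integrable_distr[OF m, of abs] gaussian_measure_abs_integrable[OF assms(1)] by (simp add: d)
  show "integrable ?P (\<lambda>z. (z k)\<^sup>2)"
    using integrable_distr[OF m, of "\<lambda>x. x\<^sup>2"] gaussian_measure_second_moment(1)[OF assms(1)]
    by (simp add: d)
  show "(\<integral>z. (z k)\<^sup>2 \<partial>?P) = \<sigma>\<^sup>2"
    using integral_distr[OF m, of "\<lambda>x. x\<^sup>2"] gaussian_measure_second_moment(2)[OF assms(1)]
    by (simp add: d)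
qed

text \<open>By Fubini, coordinate \<open>k\<close> is integrated first with the others frozen, where
  the one-dimensional identity applies. The bounds on \<open>f\<close> and \<open>f'\<close> provide
  the integrability that Fubini asks for.\<close>

lemma PiM_gaussian_integration_by_parts:
  fixes f f' :: "('i \<Rightarrow> real) \<Rightarrow> real"
  defines "P \<equiv> (\<lambda>I \<sigma>. PiM I (\<lambda>_. gaussian_measure 0 \<sigma>))"
  assumes \<sigma>: "\<sigma> \<ge> 0" and I: "finite I" "k \<in> I"
    and meas: "f \<in> borel_measurable (P I \<sigma>)" "f' \<in> borel_measurable (P I \<sigma>)"
    and f: "\<And>z y. ((\<lambda>y. f (z(k := y))) has_real_derivative f' (z(k := y))) (at y)"
    and cont: "\<And>z. continuous_on UNIV (\<lambda>y. f' (z(k := y)))"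
    and bound: "\<And>z. \<bar>f z\<bar> \<le> C" "\<And>z. \<bar>f' z\<bar> \<le> C'"
  shows "integrable (P I \<sigma>) (\<lambda>z. z k * f z)" "integrable (P I \<sigma>) f'"
    "(\<integral>z. z k * f z \<partial>P I \<sigma>) = \<sigma>\<^sup>2 * (\<integral>z. f' z \<partial>P I \<sigma>)"
proof -
  let ?G = "gaussian_measure 0 \<sigma>"
  interpret product_prob_space "\<lambda>_::'i. ?G" by (rule product_prob_space_gaussian[OF \<sigma>])
  interpret PP: prob_space "P I \<sigma>"
    unfolding P_def using prob_space_gaussian_measure[OF \<sigma>] by (intro prob_space_PiM)
  show int: "integrable (P I \<sigma>) (\<lambda>z. z k * f z)"
  proof (rule Bochner_Integration.integrable_bound[of _ "\<lambda>z. C * \<bar>z k\<bar>"])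
    show "integrable (P I \<sigma>) (\<lambda>z. C * \<bar>z k\<bar>)"
      using PiM_gaussian_coordinate_moments[OF \<sigma> I(2)] by (auto simp: P_def)
    show "(\<lambda>z. z k * f z) \<in> borel_measurable (P I \<sigma>)"
      using PiM_gaussian_coordinate_measurable[OF I(2)] meas by (auto simp: P_def)
    show "AE z in P I \<sigma>. norm (z k * f z) \<le> norm (C * \<bar>z k\<bar>)"
    proof (rule AE_I2)
      fix z
      have "\<bar>f z\<bar> * \<bar>z k\<bar> \<le> \<bar>C\<bar> * \<bar>z k\<bar>"
        using bound(1)[of z] by (intro mult_right_mono) auto
      then show "norm (z k * f z) \<le> norm (C * \<bar>z k\<bar>)"
        by (simp add: abs_mult mult_ac)
    qed
  qed
  show int': "integrable (P I \<sigma>) f'"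
    by (rule PP.integrable_const_bound[of _ C']) (use bound meas in auto)
  let ?J = "I - {k}"
  have J: "finite ?J" "k \<notin> ?J" "insert k ?J = I"
    using I by auto
  have "(\<integral>z. z k * f z \<partial>P I \<sigma>) = (\<integral>z. \<integral>y. y * f (z(k := y)) \<partial>?G \<partial>P ?J \<sigma>)"
    using product_integral_insert[OF J(1,2), of "\<lambda>z. z k * f z"] int unfolding J(3) P_def by simp
  also have "\<dots> = (\<integral>z. \<sigma>\<^sup>2 * (\<integral>y. f' (z(k := y)) \<partial>?G) \<partial>P ?J \<sigma>)"
    by (intro Bochner_Integration.integral_cong refl gaussian_integration_by_parts[OF \<sigma> f cont bound])
  also have "\<dots> = \<sigma>\<^sup>2 * (\<integral>z. f' z \<partial>P I \<sigma>)"
    using product_integral_insert[OF J(1,2), of f'] int' unfolding J(3) P_def by simp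
  finally show "(\<integral>z. z k * f z \<partial>P I \<sigma>) = \<sigma>\<^sup>2 * (\<integral>z. f' z \<partial>P I \<sigma>)" .
qed

subsection \<open>Comparison of expected maxima\<close>

text \<open>Smooth substitute for the maximum: by \<open>log_sum_exp_ge\<close> and
  \<open>log_sum_exp_le\<close> it lies between the maximum and the maximum plus
  \<open>ln (card T)\<close>.\<close>

definition log_sum_exp :: "'t set \<Rightarrow> ('t \<Rightarrow> real) \<Rightarrow> real" where
  "log_sum_exp T x = ln (\<Sum>\<tau>\<in>T. exp (x \<tau>))"

text \<open>These Gibbs weights are the partial derivatives of \<open>log_sum_exp\<close>.\<close>

definition softmax :: "'t set \<Rightarrow> ('t \<Rightarrow> real) \<Rightarrow> 't \<Rightarrow> real" where
  "softmax T x \<tau> = exp (x \<tau>) / (\<Sum>\<rho>\<in>T. exp (x \<rho>))"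

context
  fixes T :: "'t set"
  assumes T: "finite T" "T \<noteq> {}"
begin

lemma sum_exp_pos: "(\<Sum>\<tau>\<in>T. exp (x \<tau> :: real)) > 0"
  using T by (intro sum_pos) auto

lemma softmax_nonneg: "softmax T x \<tau> \<ge> 0"
  using sum_exp_pos[of x] by (simp add: softmax_def)

lemma sum_softmax: "(\<Sum>\<tau>\<in>T. softmax T x \<tau>) = 1"
  using sum_exp_pos[of x] by (simp add: softmax_def sum_divide_distrib[symmetric])

lemma softmax_le_1: "\<tau> \<in> T \<Longrightarrow> softmax T x \<tau> \<le> 1"
  using member_le_sum[of \<tau> T "softmax T x"] T softmax_nonneg sum_softmax[of x] by auto

lemma log_sum_exp_ge: "\<tau> \<in> T \<Longrightarrow> x \<tau> \<le> log_sum_exp T x"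
proof -
  assume "\<tau> \<in> T"
  then have "exp (x \<tau>) \<le> (\<Sum>\<tau>\<in>T. exp (x \<tau>))"
    using T by (intro member_le_sum) auto
  then show ?thesis
    unfolding log_sum_exp_def using sum_exp_pos[of x] by (simp add: ln_ge_iff)
qed

lemma log_sum_exp_le:
  assumes "\<And>\<tau>. \<tau> \<in> T \<Longrightarrow> x \<tau> \<le> R"
  shows "log_sum_exp T x \<le> ln (card T) + R"
proof -
  have c: "card T > 0" using T by (simp add: card_gt_0_iff)
  have "(\<Sum>\<tau>\<in>T. exp (x \<tau>)) \<le> card T * exp R"
    using sum_mono[of T "\<lambda>\<tau>. exp (x \<tau>)" "\<lambda>_. exp R"] assms by simp
  then have "log_sum_exp T x \<le> ln (card T * exp R)"
    unfolding log_sum_exp_def using sum_exp_pos[of x] c by (subst ln_le_cancel_iff) auto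
  then show ?thesis using c by (simp add: ln_mult)
qed

text \<open>Growth at most linear in the arguments, hence an integrable majorant under Gaussian
  measures.\<close>

lemma abs_log_sum_exp_le: "\<bar>log_sum_exp T x\<bar> \<le> ln (card T) + (\<Sum>\<tau>\<in>T. \<bar>x \<tau>\<bar>)"
proof -
  have c: "card T \<ge> 1" using T by (simp add: Suc_leI card_gt_0_iff)
  have m: "\<bar>x \<tau>\<bar> \<le> (\<Sum>\<tau>\<in>T. \<bar>x \<tau>\<bar>)" if "\<tau> \<in> T" for \<tau>
    using that T by (intro member_le_sum) auto
  obtain \<tau> where \<tau>: "\<tau> \<in> T" using T by auto
  have "log_sum_exp T x \<le> ln (card T) + (\<Sum>\<tau>\<in>T. \<bar>x \<tau>\<bar>)"
    using m by (intro log_sum_exp_le) (auto intro: order_trans[OF abs_ge_self])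
  moreover have "- (\<Sum>\<tau>\<in>T. \<bar>x \<tau>\<bar>) \<le> log_sum_exp T x"
    using log_sum_exp_ge[OF \<tau>, of x] m[OF \<tau>] by linarith
  moreover have "ln (card T) \<ge> 0" using c by simp
  ultimately show ?thesis by linarith
qed

lemma log_sum_exp_has_real_derivative:
  assumes "\<And>\<tau>. \<tau> \<in> T \<Longrightarrow> (x \<tau> has_real_derivative x' \<tau>) (at t)"
  shows "((\<lambda>t. log_sum_exp T (\<lambda>\<tau>. x \<tau> t)) has_real_derivative
      (\<Sum>\<tau>\<in>T. softmax T (\<lambda>\<tau>. x \<tau> t) \<tau> * x' \<tau>)) (at t)"
  unfolding log_sum_exp_def softmax_def
  by (rule derivative_eq_intros assms sum_exp_pos refl | assumption)+
     (simp add: sum_divide_distrib sum_distrib_left sum_distrib_right mult_ac)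

lemma softmax_has_real_derivative:
  assumes "\<And>\<tau>. \<tau> \<in> T \<Longrightarrow> (x \<tau> has_real_derivative x' \<tau>) (at t)" "\<tau> \<in> T"
  shows "((\<lambda>t. softmax T (\<lambda>\<tau>. x \<tau> t) \<tau>) has_real_derivative
      softmax T (\<lambda>\<tau>. x \<tau> t) \<tau> * (x' \<tau> - (\<Sum>\<rho>\<in>T. softmax T (\<lambda>\<tau>. x \<tau> t) \<rho> * x' \<rho>))) (at t)"
proof -
  let ?S = "\<Sum>\<rho>\<in>T. exp (x \<rho> t)"
  have S: "?S \<noteq> 0" using sum_exp_pos[of "\<lambda>\<rho>. x \<rho> t"] by simp
  have "((\<lambda>t. softmax T (\<lambda>\<tau>. x \<tau> t) \<tau>) has_real_derivative
     (exp (x \<tau> t) * x' \<tau> * ?S - exp (x \<tau> t) * (\<Sum>\<rho>\<in>T. exp (x \<rho> t) * x' \<rho>)) / (?S * ?S)) (at t)"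
    unfolding softmax_def
    by (rule derivative_eq_intros assms S refl | assumption)+
  moreover have "(exp (x \<tau> t) * x' \<tau> * ?S - exp (x \<tau> t) * (\<Sum>\<rho>\<in>T. exp (x \<rho> t) * x' \<rho>)) / (?S * ?S) =
     softmax T (\<lambda>\<tau>. x \<tau> t) \<tau> * (x' \<tau> - (\<Sum>\<rho>\<in>T. softmax T (\<lambda>\<tau>. x \<tau> t) \<rho> * x' \<rho>))"
    unfolding softmax_def using S
    by (simp add: sum_divide_distrib[symmetric] field_simps)
  ultimately show ?thesis by simp
qed

end

text \<open>Both sides are the covariance of \<open>a\<close> and \<open>b\<close> under the weights
  \<open>p\<close>; the right side writes it with two independent samples. In that form only
  increments occur, which is what the comparison hypothesis controls.\<close>

lemma weighted_covariance_identity: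
  fixes p a b :: "'t \<Rightarrow> real"
  assumes "(\<Sum>\<tau>\<in>T. p \<tau>) = 1"
  shows "(\<Sum>\<tau>\<in>T. a \<tau> * (p \<tau> * (b \<tau> - (\<Sum>\<rho>\<in>T. p \<rho> * b \<rho>)))) =
    (\<Sum>\<tau>\<in>T. \<Sum>\<rho>\<in>T. p \<tau> * p \<rho> * ((a \<tau> - a \<rho>) * (b \<tau> - b \<rho>))) / 2"
proof -
  let ?A = "\<Sum>\<tau>\<in>T. p \<tau> * a \<tau>" and ?B = "\<Sum>\<tau>\<in>T. p \<tau> * b \<tau>" and ?AB = "\<Sum>\<tau>\<in>T. p \<tau> * (a \<tau> * b \<tau>)"
  have "(\<Sum>\<tau>\<in>T. \<Sum>\<rho>\<in>T. p \<tau> * p \<rho> * ((a \<tau> - a \<rho>) * (b \<tau> - b \<rho>))) =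
     (\<Sum>\<tau>\<in>T. \<Sum>\<rho>\<in>T. (p \<tau> * (a \<tau> * b \<tau>)) * p \<rho> - (p \<tau> * a \<tau>) * (p \<rho> * b \<rho>)
        - (p \<tau> * b \<tau>) * (p \<rho> * a \<rho>) + p \<tau> * (p \<rho> * (a \<rho> * b \<rho>)))"
    by (intro sum.cong refl) (simp add: algebra_simps)
  also have "\<dots> = ?AB * (\<Sum>\<rho>\<in>T. p \<rho>) - ?A * ?B - ?B * ?A + (\<Sum>\<tau>\<in>T. p \<tau>) * ?AB"
    by (simp only: sum.distrib sum_subtractf sum_product)
  also have "\<dots> = 2 * (?AB - ?A * ?B)"
    by (simp add: assms)
  also have "?AB - ?A * ?B = (\<Sum>\<tau>\<in>T. a \<tau> * (p \<tau> * (b \<tau> - ?B)))"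
    by (simp add: right_diff_distrib sum_subtractf sum_distrib_right mult_ac)
  finally show ?thesis by simp
qed

lemma linear_form_measurable:
  assumes "finite I"
  shows "(\<lambda>z. \<Sum>k\<in>I. c k * z k) \<in> borel_measurable (PiM I (\<lambda>_. gaussian_measure 0 \<sigma>))"
  by (intro borel_measurable_sum borel_measurable_times borel_measurable_const PiM_gaussian_coordinate_measurable)

lemma log_sum_exp_integrable:
  fixes c :: "'t \<Rightarrow> 'i \<Rightarrow> real"
  assumes \<sigma>: "\<sigma> \<ge> 0" and I: "finite I" and T: "finite T" "T \<noteq> {}"
  shows "integrable (PiM I (\<lambda>_. gaussian_measure 0 \<sigma>)) (\<lambda>z. log_sum_exp T (\<lambda>\<tau>. \<Sum>k\<in>I. c \<tau> k * z k))"
proof (rule Bochner_Integration.integrable_bound)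
  interpret prob_space "PiM I (\<lambda>_. gaussian_measure 0 \<sigma>)"
    using prob_space_gaussian_measure[OF \<sigma>] by (intro prob_space_PiM)
  show "integrable (PiM I (\<lambda>_. gaussian_measure 0 \<sigma>)) (\<lambda>z. ln (card T) + (\<Sum>\<tau>\<in>T. \<Sum>k\<in>I. \<bar>c \<tau> k\<bar> * \<bar>z k\<bar>))"
    by (intro Bochner_Integration.integrable_add Bochner_Integration.integrable_sum integrable_mult_right
        PiM_gaussian_coordinate_moments(1)[OF \<sigma>]) auto
  show "(\<lambda>z. log_sum_exp T (\<lambda>\<tau>. \<Sum>k\<in>I. c \<tau> k * z k)) \<in> borel_measurable (PiM I (\<lambda>_. gaussian_measure 0 \<sigma>))"
    unfolding log_sum_exp_def using linear_form_measurable[OF I] by measurable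
  show "AE z in PiM I (\<lambda>_. gaussian_measure 0 \<sigma>). norm (log_sum_exp T (\<lambda>\<tau>. \<Sum>k\<in>I. c \<tau> k * z k))
      \<le> norm (ln (card T) + (\<Sum>\<tau>\<in>T. \<Sum>k\<in>I. \<bar>c \<tau> k\<bar> * \<bar>z k\<bar>))"
  proof (rule AE_I2)
    fix z
    have "(\<Sum>\<tau>\<in>T. \<bar>\<Sum>k\<in>I. c \<tau> k * z k\<bar>) \<le> (\<Sum>\<tau>\<in>T. \<Sum>k\<in>I. \<bar>c \<tau> k\<bar> * \<bar>z k\<bar>)"
      unfolding abs_mult[symmetric] by (intro sum_mono sum_abs)
    with abs_log_sum_exp_le[OF T, of "\<lambda>\<tau>. \<Sum>k\<in>I. c \<tau> k * z k"]
    show "norm (log_sum_exp T (\<lambda>\<tau>. \<Sum>k\<in>I. c \<tau> k * z k))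
      \<le> norm (ln (card T) + (\<Sum>\<tau>\<in>T. \<Sum>k\<in>I. \<bar>c \<tau> k\<bar> * \<bar>z k\<bar>))"
      by simp
  qed
qed

text \<open>
  Integration by parts turns the derivative of the expectation along the path w into a nonnegative
  combination of the derivatives of the squared increments, because the Hessian of log-sum-exp is
  the covariance matrix of the softmax weights.
\<close>

lemma expectation_log_sum_exp_mono:
  fixes w w' :: "real \<Rightarrow> 't \<Rightarrow> 'i \<Rightarrow> real"
  defines "P \<equiv> (\<lambda>I \<sigma>. PiM I (\<lambda>_. gaussian_measure 0 \<sigma>))"
  assumes \<sigma>: "\<sigma> \<ge> 0" and I: "finite I" and T: "finite T" "T \<noteq> {}"
    and w: "\<And>t \<tau> k. ((\<lambda>t. w t \<tau> k) has_real_derivative w' t \<tau> k) (at t)"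
    and bound: "\<And>t \<tau> k. \<bar>w' t \<tau> k\<bar> \<le> C \<tau> k"
    and mono: "\<And>t \<tau> \<rho>. \<lbrakk>a \<le> t; t \<le> b; \<tau> \<in> T; \<rho> \<in> T\<rbrakk> \<Longrightarrow>
      0 \<le> (\<Sum>k\<in>I. (w' t \<tau> k - w' t \<rho> k) * (w t \<tau> k - w t \<rho> k))"
    and "a \<le> b"
  shows "(\<integral>z. log_sum_exp T (\<lambda>\<tau>. \<Sum>k\<in>I. w a \<tau> k * z k) \<partial>P I \<sigma>) \<le>
    (\<integral>z. log_sum_exp T (\<lambda>\<tau>. \<Sum>k\<in>I. w b \<tau> k * z k) \<partial>P I \<sigma>)"
proof -
  define s where "s t z = softmax T (\<lambda>\<tau>. \<Sum>k\<in>I. w t \<tau> k * z k)" for t z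
  \<comment> \<open>The partial derivative of the weight \<open>s t z \<tau>\<close> in the
    coordinate \<open>z k\<close>, which enters the form of index \<rho> with coefficient
    \<open>w t \<rho> k\<close>.\<close>
  define d where "d t k \<tau> z = s t z \<tau> * (w t \<tau> k - (\<Sum>\<rho>\<in>T. s t z \<rho> * w t \<rho> k))" for t k \<tau> z
  define \<Phi>' where "\<Phi>' t = (\<integral>z. (\<Sum>\<tau>\<in>T. s t z \<tau> * (\<Sum>k\<in>I. w' t \<tau> k * z k)) \<partial>P I \<sigma>)" for t
  have s_nonneg: "s t z \<tau> \<ge> 0" and s_sum: "(\<Sum>\<tau>\<in>T. s t z \<tau>) = 1" for t z \<tau>
    by (simp_all add: s_def softmax_nonneg[OF T] sum_softmax[OF T])
  have s_le: "\<tau> \<in> T \<Longrightarrow> s t z \<tau> \<le> 1" for t z \<tau>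
    by (simp add: s_def softmax_le_1[OF T])
  have s_meas: "(\<lambda>z. s t z \<tau>) \<in> borel_measurable (P I \<sigma>)" for t \<tau>
    unfolding s_def softmax_def P_def using linear_form_measurable[OF I] by measurable
  have deriv: "((\<lambda>t. \<integral>z. log_sum_exp T (\<lambda>\<tau>. \<Sum>k\<in>I. w t \<tau> k * z k) \<partial>P I \<sigma>) has_real_derivative \<Phi>' t) (at t)" for t
    unfolding \<Phi>'_def
  proof (rule has_real_derivative_integral)
    show "integrable (P I \<sigma>) (\<lambda>z. log_sum_exp T (\<lambda>\<tau>. \<Sum>k\<in>I. w t \<tau> k * z k))" for t
      unfolding P_def by (rule log_sum_exp_integrable[OF \<sigma> I T])
    show "(\<lambda>z. \<Sum>\<tau>\<in>T. s t z \<tau> * (\<Sum>k\<in>I. w' t \<tau> k * z k)) \<in> borel_measurable (P I \<sigma>)" for t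
      unfolding P_def by (intro borel_measurable_sum borel_measurable_times borel_measurable_const
          s_meas[unfolded P_def] PiM_gaussian_coordinate_measurable)
    show "((\<lambda>t. log_sum_exp T (\<lambda>\<tau>. \<Sum>k\<in>I. w t \<tau> k * z k)) has_real_derivative
         (\<Sum>\<tau>\<in>T. s t z \<tau> * (\<Sum>k\<in>I. w' t \<tau> k * z k))) (at t)" for t z
      unfolding s_def by (rule log_sum_exp_has_real_derivative[OF T]) (auto intro!: derivative_eq_intros w)
    \<comment> \<open>A majorant free of \<open>t\<close>: the weights are at most 1 and
      \<open>C\<close> bounds the velocity of the path uniformly.\<close>
    show "integrable (P I \<sigma>) (\<lambda>z. \<Sum>\<tau>\<in>T. \<Sum>k\<in>I. C \<tau> k * \<bar>z k\<bar>)"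
      unfolding P_def by (intro Bochner_Integration.integrable_sum integrable_mult_right
        PiM_gaussian_coordinate_moments(1)[OF \<sigma>]) auto
    show "\<bar>\<Sum>\<tau>\<in>T. s t z \<tau> * (\<Sum>k\<in>I. w' t \<tau> k * z k)\<bar> \<le> (\<Sum>\<tau>\<in>T. \<Sum>k\<in>I. C \<tau> k * \<bar>z k\<bar>)" for t z
    proof -
      have "\<bar>s t z \<tau> * (\<Sum>k\<in>I. w' t \<tau> k * z k)\<bar> \<le> (\<Sum>k\<in>I. C \<tau> k * \<bar>z k\<bar>)" if "\<tau> \<in> T" for \<tau>
      proof -
        have "\<bar>s t z \<tau> * (\<Sum>k\<in>I. w' t \<tau> k * z k)\<bar> \<le> 1 * \<bar>\<Sum>k\<in>I. w' t \<tau> k * z k\<bar>"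
          unfolding abs_mult using s_nonneg[of t z \<tau>] s_le[OF that, of t z] by (intro mult_right_mono) auto
        also have "\<dots> \<le> (\<Sum>k\<in>I. \<bar>w' t \<tau> k * z k\<bar>)" by simp
        also have "\<dots> \<le> (\<Sum>k\<in>I. C \<tau> k * \<bar>z k\<bar>)"
          unfolding abs_mult by (intro sum_mono mult_right_mono bound) auto
        finally show ?thesis .
      qed
      then show ?thesis by (intro order_trans[OF sum_abs sum_mono])
    qed
  qed
  have ibp: "integrable (P I \<sigma>) (\<lambda>z. z k * s t z \<tau>)" "integrable (P I \<sigma>) (d t k \<tau>)"
    "(\<integral>z. z k * s t z \<tau> \<partial>P I \<sigma>) = \<sigma>\<^sup>2 * (\<integral>z. d t k \<tau> z \<partial>P I \<sigma>)" if "k \<in> I" "\<tau> \<in> T" for k \<tau> t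
  proof -
    have lin: "((\<lambda>y. \<Sum>j\<in>I. w t \<rho> j * (z(k := y)) j) has_real_derivative w t \<rho> k) (at y)" for z y \<rho>
    proof -
      have "((\<lambda>y. w t \<rho> j * (z(k := y)) j) has_real_derivative (if j = k then w t \<rho> j else 0)) (at y)" for j
        by (auto intro!: derivative_eq_intros)
      then have "((\<lambda>y. \<Sum>j\<in>I. w t \<rho> j * (z(k := y)) j) has_real_derivative
          (\<Sum>j\<in>I. if j = k then w t \<rho> j else 0)) (at y)"
        by (rule DERIV_sum)
      then show ?thesis using I that by simp
    qed
    have sd: "((\<lambda>y. s t (z(k := y)) \<rho>) has_real_derivative d t k \<rho> (z(k := y))) (at y)" if "\<rho> \<in> T" for z y \<rho>
      unfolding s_def d_def by (rule softmax_has_real_derivative[OF T lin that])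
    have sc: "continuous_on UNIV (\<lambda>y. s t (z(k := y)) \<rho>)" if "\<rho> \<in> T" for z \<rho>
      by (rule DERIV_continuous_on, rule has_field_derivative_at_within, rule sd[OF that])
    have dc: "continuous_on UNIV (\<lambda>y. d t k \<tau> (z(k := y)))" for z
      unfolding d_def by (intro continuous_intros sc that)
    have dm: "d t k \<tau> \<in> borel_measurable (P I \<sigma>)"
      unfolding d_def using s_meas by measurable
    have sb: "\<bar>s t z \<tau>\<bar> \<le> 1" for z
      using s_nonneg[of t z \<tau>] s_le[OF that(2), of t z] by simp
    have db: "\<bar>d t k \<tau> z\<bar> \<le> \<bar>w t \<tau> k\<bar> + (\<Sum>\<rho>\<in>T. \<bar>w t \<rho> k\<bar>)" for z
    proof -
      have "\<bar>d t k \<tau> z\<bar> \<le> 1 * \<bar>w t \<tau> k - (\<Sum>\<rho>\<in>T. s t z \<rho> * w t \<rho> k)\<bar>"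
        unfolding d_def abs_mult by (intro mult_right_mono sb) auto
      also have "\<dots> \<le> \<bar>w t \<tau> k\<bar> + \<bar>\<Sum>\<rho>\<in>T. s t z \<rho> * w t \<rho> k\<bar>" by simp
      also have "\<bar>\<Sum>\<rho>\<in>T. s t z \<rho> * w t \<rho> k\<bar> \<le> (\<Sum>\<rho>\<in>T. \<bar>s t z \<rho> * w t \<rho> k\<bar>)" by simp
      also have "\<dots> \<le> (\<Sum>\<rho>\<in>T. \<bar>w t \<rho> k\<bar>)"
        unfolding abs_mult using s_nonneg s_le by (intro sum_mono mult_left_le_one_le) auto
      finally show ?thesis by simp
    qed
    show "integrable (P I \<sigma>) (\<lambda>z. z k * s t z \<tau>)" "integrable (P I \<sigma>) (d t k \<tau>)"
      "(\<integral>z. z k * s t z \<tau> \<partial>P I \<sigma>) = \<sigma>\<^sup>2 * (\<integral>z. d t k \<tau> z \<partial>P I \<sigma>)"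
      using PiM_gaussian_integration_by_parts[OF \<sigma> I \<open>k \<in> I\<close> s_meas[unfolded P_def] dm[unfolded P_def] sd[OF that(2)] dc sb db]
      by (simp_all add: P_def)
  qed
  have nonneg: "\<Phi>' t \<ge> 0" if t: "a \<le> t" "t \<le> b" for t
  proof -
    \<comment> \<open>Regrouped so that each term is a Gaussian coordinate times a weight, the shape
      required by \<open>ibp\<close>.\<close>
    have "\<Phi>' t = (\<integral>z. (\<Sum>k\<in>I. \<Sum>\<tau>\<in>T. w' t \<tau> k * (z k * s t z \<tau>)) \<partial>P I \<sigma>)"
      unfolding \<Phi>'_def by (subst sum.swap) (simp add: sum_distrib_left mult_ac)
    also have "\<dots> = (\<Sum>k\<in>I. \<Sum>\<tau>\<in>T. w' t \<tau> k * (\<integral>z. z k * s t z \<tau> \<partial>P I \<sigma>))"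
      using ibp(1) by (simp add: Bochner_Integration.integral_sum Bochner_Integration.integrable_sum)
    also have "\<dots> = (\<Sum>k\<in>I. \<Sum>\<tau>\<in>T. w' t \<tau> k * (\<sigma>\<^sup>2 * (\<integral>z. d t k \<tau> z \<partial>P I \<sigma>)))"
      by (intro sum.cong refl) (simp add: ibp(3))
    also have "\<dots> = \<sigma>\<^sup>2 * (\<integral>z. (\<Sum>k\<in>I. \<Sum>\<tau>\<in>T. w' t \<tau> k * d t k \<tau> z) \<partial>P I \<sigma>)"
      using ibp(2) by (simp add: Bochner_Integration.integral_sum Bochner_Integration.integrable_sum sum_distrib_left mult_ac)
    \<comment> \<open>The covariance identity is used in each coordinate separately; summing over
      \<open>k\<close> inside the pairs then produces the expression that \<open>mono\<close> makes
      nonnegative.\<close>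
    also have "(\<lambda>z. \<Sum>k\<in>I. \<Sum>\<tau>\<in>T. w' t \<tau> k * d t k \<tau> z) =
       (\<lambda>z. (\<Sum>\<tau>\<in>T. \<Sum>\<rho>\<in>T. s t z \<tau> * s t z \<rho> * (\<Sum>k\<in>I. (w' t \<tau> k - w' t \<rho> k) * (w t \<tau> k - w t \<rho> k))) / 2)"
    proof
      fix z
      have "(\<Sum>k\<in>I. \<Sum>\<tau>\<in>T. w' t \<tau> k * d t k \<tau> z) =
        (\<Sum>k\<in>I. (\<Sum>\<tau>\<in>T. \<Sum>\<rho>\<in>T. s t z \<tau> * s t z \<rho> * ((w' t \<tau> k - w' t \<rho> k) * (w t \<tau> k - w t \<rho> k))) / 2)"
        unfolding d_def by (intro sum.cong refl weighted_covariance_identity s_sum)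
      also have "\<dots> = (\<Sum>\<tau>\<in>T. \<Sum>\<rho>\<in>T. \<Sum>k\<in>I. s t z \<tau> * s t z \<rho> * ((w' t \<tau> k - w' t \<rho> k) * (w t \<tau> k - w t \<rho> k))) / 2"
        unfolding sum_divide_distrib[symmetric]
        by (rule arg_cong[where f = "\<lambda>x. x / 2"], subst sum.swap, rule sum.cong[OF refl], rule sum.swap)
      finally show "(\<Sum>k\<in>I. \<Sum>\<tau>\<in>T. w' t \<tau> k * d t k \<tau> z) =
        (\<Sum>\<tau>\<in>T. \<Sum>\<rho>\<in>T. s t z \<tau> * s t z \<rho> * (\<Sum>k\<in>I. (w' t \<tau> k - w' t \<rho> k) * (w t \<tau> k - w t \<rho> k))) / 2"
        by (simp add: sum_distrib_left)
    qed
    also have "\<sigma>\<^sup>2 * (\<integral>z. (\<Sum>\<tau>\<in>T. \<Sum>\<rho>\<in>T. s t z \<tau> * s t z \<rho> * (\<Sum>k\<in>I. (w' t \<tau> k - w' t \<rho> k) * (w t \<tau> k - w t \<rho> k))) / 2 \<partial>P I \<sigma>) \<ge> 0"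
      by (intro mult_nonneg_nonneg Bochner_Integration.integral_nonneg divide_nonneg_nonneg sum_nonneg s_nonneg mono t) auto
    finally show ?thesis .
  qed
  show ?thesis
    by (rule DERIV_nonneg_imp_nondecreasing[OF \<open>a \<le> b\<close>]) (use deriv nonneg in blast)
qed

section \<open>The Sudakov-Fernique inequality for finite families\<close>

lemma Max_linear_forms_integrable:
  fixes a :: "'t \<Rightarrow> 'i \<Rightarrow> real"
  assumes \<sigma>: "\<sigma> \<ge> 0" and I: "finite I" and T: "finite T" "T \<noteq> {}"
  shows "integrable (PiM I (\<lambda>_. gaussian_measure 0 \<sigma>)) (\<lambda>z. MAX \<tau>\<in>T. \<Sum>k\<in>I. a \<tau> k * z k)"
proof (rule Bochner_Integration.integrable_bound)
  show "integrable (PiM I (\<lambda>_. gaussian_measure 0 \<sigma>)) (\<lambda>z. \<Sum>\<tau>\<in>T. \<Sum>k\<in>I. \<bar>a \<tau> k\<bar> * \<bar>z k\<bar>)"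
    by (intro Bochner_Integration.integrable_sum integrable_mult_right
        PiM_gaussian_coordinate_moments(1)[OF \<sigma>]) auto
  show "(\<lambda>z. MAX \<tau>\<in>T. \<Sum>k\<in>I. a \<tau> k * z k) \<in> borel_measurable (PiM I (\<lambda>_. gaussian_measure 0 \<sigma>))"
    by (intro borel_measurable_Max T linear_form_measurable I)
  show "AE z in PiM I (\<lambda>_. gaussian_measure 0 \<sigma>). norm (MAX \<tau>\<in>T. \<Sum>k\<in>I. a \<tau> k * z k)
      \<le> norm (\<Sum>\<tau>\<in>T. \<Sum>k\<in>I. \<bar>a \<tau> k\<bar> * \<bar>z k\<bar>)"
  proof (rule AE_I2)
    fix z
    have "(MAX \<tau>\<in>T. \<Sum>k\<in>I. a \<tau> k * z k) \<in> (\<lambda>\<tau>. \<Sum>k\<in>I. a \<tau> k * z k) ` T"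
      using T by (intro Max_in) auto
    then obtain \<tau> where \<tau>: "\<tau> \<in> T" "(MAX \<tau>\<in>T. \<Sum>k\<in>I. a \<tau> k * z k) = (\<Sum>k\<in>I. a \<tau> k * z k)"
      by auto
    have "\<bar>\<Sum>k\<in>I. a \<tau> k * z k\<bar> \<le> (\<Sum>k\<in>I. \<bar>a \<tau> k\<bar> * \<bar>z k\<bar>)"
      unfolding abs_mult[symmetric] by (rule sum_abs)
    also have "\<dots> \<le> (\<Sum>\<tau>\<in>T. \<Sum>k\<in>I. \<bar>a \<tau> k\<bar> * \<bar>z k\<bar>)"
      using \<tau> T by (intro member_le_sum sum_nonneg) auto
    finally show "norm (MAX \<tau>\<in>T. \<Sum>k\<in>I. a \<tau> k * z k) \<le> norm (\<Sum>\<tau>\<in>T. \<Sum>k\<in>I. \<bar>a \<tau> k\<bar> * \<bar>z k\<bar>)"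
      using \<tau> by simp
  qed
qed

text \<open>\<open>disjoint\<close> makes the two processes independent, so that along the rotation
  the squared increments interpolate monotonically between those of \<open>a\<close> and those of
  \<open>c\<close>. The larger process is represented by any integrable upper bound
  \<open>R\<close>, since in the application its supremum is explicit.\<close>

lemma Sudakov_Fernique:
  fixes a c :: "'t \<Rightarrow> 'i \<Rightarrow> real"
  defines "P \<equiv> (\<lambda>I \<sigma>. PiM I (\<lambda>_. gaussian_measure 0 \<sigma>))"
  assumes \<sigma>: "\<sigma> \<ge> 0" and I: "finite I" and T: "finite T" "T \<noteq> {}"
    and disjoint: "\<And>\<tau> \<rho> k. k \<in> I \<Longrightarrow> a \<tau> k * c \<rho> k = 0"
    and increments: "\<And>\<tau> \<rho>. \<lbrakk>\<tau> \<in> T; \<rho> \<in> T\<rbrakk> \<Longrightarrow>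
      (\<Sum>k\<in>I. (a \<tau> k - a \<rho> k)\<^sup>2) \<le> (\<Sum>k\<in>I. (c \<tau> k - c \<rho> k)\<^sup>2)"
    and R: "integrable (P I \<sigma>) R" "\<And>z \<tau>. \<tau> \<in> T \<Longrightarrow> (\<Sum>k\<in>I. c \<tau> k * z k) \<le> R z"
  shows "(\<integral>z. (MAX \<tau>\<in>T. \<Sum>k\<in>I. a \<tau> k * z k) \<partial>P I \<sigma>) \<le> (\<integral>z. R z \<partial>P I \<sigma>)"
proof -
  interpret prob_space "P I \<sigma>"
    unfolding P_def using prob_space_gaussian_measure[OF \<sigma>] by (intro prob_space_PiM)
  let ?M = "\<integral>z. (MAX \<tau>\<in>T. \<Sum>k\<in>I. a \<tau> k * z k) \<partial>P I \<sigma>"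
  \<comment> \<open>The error \<open>ln (card T)\<close> does not grow with the scale
    \<beta>.\<close>
  have main: "\<beta> * ?M \<le> ln (card T) + \<beta> * (\<integral>z. R z \<partial>P I \<sigma>)" if "\<beta> > 0" for \<beta> :: real
  proof -
    \<comment> \<open>A quarter turn from \<open>a\<close> at 0 to \<open>c\<close> at
      \<open>pi / 2\<close>, scaled by \<beta>.\<close>
    define w where "w t \<tau> k = \<beta> * (cos t * a \<tau> k + sin t * c \<tau> k)" for t \<tau> k
    define w' where "w' t \<tau> k = \<beta> * (- sin t * a \<tau> k + cos t * c \<tau> k)" for t \<tau> k
    have int: "integrable (P I \<sigma>) (\<lambda>z. log_sum_exp T (\<lambda>\<tau>. \<Sum>k\<in>I. w t \<tau> k * z k))" for t
      unfolding P_def by (rule log_sum_exp_integrable[OF \<sigma> I T])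
    have "\<beta> * ?M = (\<integral>z. \<beta> * (MAX \<tau>\<in>T. \<Sum>k\<in>I. a \<tau> k * z k) \<partial>P I \<sigma>)" by simp
    also have "\<dots> \<le> (\<integral>z. log_sum_exp T (\<lambda>\<tau>. \<Sum>k\<in>I. w 0 \<tau> k * z k) \<partial>P I \<sigma>)"
    proof (rule integral_mono)
      show "integrable (P I \<sigma>) (\<lambda>z. \<beta> * (MAX \<tau>\<in>T. \<Sum>k\<in>I. a \<tau> k * z k))"
        unfolding P_def by (intro integrable_mult_right Max_linear_forms_integrable \<sigma> I T)
      fix z
      have "(MAX \<tau>\<in>T. \<Sum>k\<in>I. a \<tau> k * z k) \<in> (\<lambda>\<tau>. \<Sum>k\<in>I. a \<tau> k * z k) ` T"
        using T by (intro Max_in) auto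
      then obtain \<tau> where \<tau>: "\<tau> \<in> T" "(MAX \<tau>\<in>T. \<Sum>k\<in>I. a \<tau> k * z k) = (\<Sum>k\<in>I. a \<tau> k * z k)"
        by auto
      show "\<beta> * (MAX \<tau>\<in>T. \<Sum>k\<in>I. a \<tau> k * z k) \<le> log_sum_exp T (\<lambda>\<tau>. \<Sum>k\<in>I. w 0 \<tau> k * z k)"
        using log_sum_exp_ge[OF T \<tau>(1), of "\<lambda>\<tau>. \<Sum>k\<in>I. w 0 \<tau> k * z k"]
        unfolding \<tau>(2) by (simp add: w_def sum_distrib_left mult_ac)
    qed (rule int)
    also have "\<dots> \<le> (\<integral>z. log_sum_exp T (\<lambda>\<tau>. \<Sum>k\<in>I. w (pi / 2) \<tau> k * z k) \<partial>P I \<sigma>)"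
      unfolding P_def
    proof (rule expectation_log_sum_exp_mono[OF \<sigma> I T, of w w'])
      show "((\<lambda>t. w t \<tau> k) has_real_derivative w' t \<tau> k) (at t)" for t \<tau> k
        unfolding w_def w'_def by (auto intro!: derivative_eq_intros)
      show "\<bar>w' t \<tau> k\<bar> \<le> \<beta> * (\<bar>a \<tau> k\<bar> + \<bar>c \<tau> k\<bar>)" for t \<tau> k
      proof -
        have "\<bar>- sin t * a \<tau> k + cos t * c \<tau> k\<bar> \<le> \<bar>sin t\<bar> * \<bar>a \<tau> k\<bar> + \<bar>cos t\<bar> * \<bar>c \<tau> k\<bar>"
          by (rule order_trans[OF abs_triangle_ineq]) (simp add: abs_mult)
        also have "\<dots> \<le> \<bar>a \<tau> k\<bar> + \<bar>c \<tau> k\<bar>"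
          by (intro add_mono mult_left_le_one_le) auto
        finally show ?thesis using that by (simp add: w'_def abs_mult)
      qed
      show "0 \<le> (\<Sum>k\<in>I. (w' t \<tau> k - w' t \<rho> k) * (w t \<tau> k - w t \<rho> k))"
        if t: "0 \<le> t" "t \<le> pi / 2" and "\<tau> \<in> T" "\<rho> \<in> T" for t \<tau> \<rho>
      proof -
        have "(\<Sum>k\<in>I. (w' t \<tau> k - w' t \<rho> k) * (w t \<tau> k - w t \<rho> k)) =
          (\<Sum>k\<in>I. \<beta>\<^sup>2 * sin t * cos t * ((c \<tau> k - c \<rho> k)\<^sup>2 - (a \<tau> k - a \<rho> k)\<^sup>2))"
        proof (rule sum.cong[OF refl])
          fix k assume "k \<in> I"
          then have 0: "(a \<tau> k - a \<rho> k) * (c \<tau> k - c \<rho> k) = 0"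
            by (simp add: algebra_simps disjoint)
          \<comment> \<open>The cross term carries the product of an \<open>a\<close> increment and
            a \<open>c\<close> increment, which vanishes by disjointness; the remaining coefficient
            is nonnegative because sine and cosine are so on the quarter turn.\<close>
          have "(w' t \<tau> k - w' t \<rho> k) * (w t \<tau> k - w t \<rho> k) =
             \<beta>\<^sup>2 * sin t * cos t * ((c \<tau> k - c \<rho> k)\<^sup>2 - (a \<tau> k - a \<rho> k)\<^sup>2)
             + \<beta>\<^sup>2 * ((cos t)\<^sup>2 - (sin t)\<^sup>2) * ((a \<tau> k - a \<rho> k) * (c \<tau> k - c \<rho> k))"
            unfolding w_def w'_def by (simp add: power2_eq_square algebra_simps)
          then show "(w' t \<tau> k - w' t \<rho> k) * (w t \<tau> k - w t \<rho> k) =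
             \<beta>\<^sup>2 * sin t * cos t * ((c \<tau> k - c \<rho> k)\<^sup>2 - (a \<tau> k - a \<rho> k)\<^sup>2)"
            by (simp only: 0)
        qed
        also have "\<dots> = \<beta>\<^sup>2 * sin t * cos t * ((\<Sum>k\<in>I. (c \<tau> k - c \<rho> k)\<^sup>2) - (\<Sum>k\<in>I. (a \<tau> k - a \<rho> k)\<^sup>2))"
          by (simp only: sum_distrib_left[symmetric] sum_subtractf)
        also have "\<dots> \<ge> 0"
          using t increments[OF that(3,4)] by (intro mult_nonneg_nonneg sin_ge_zero cos_ge_zero) auto
        finally show ?thesis .
      qed
    qed simp
    also have "\<dots> \<le> (\<integral>z. ln (card T) + \<beta> * R z \<partial>P I \<sigma>)"
    proof (rule integral_mono[OF int])
      show "integrable (P I \<sigma>) (\<lambda>z. ln (card T) + \<beta> * R z)" using R by simp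
      fix z
      show "log_sum_exp T (\<lambda>\<tau>. \<Sum>k\<in>I. w (pi / 2) \<tau> k * z k) \<le> ln (card T) + \<beta> * R z"
      proof (rule log_sum_exp_le[OF T])
        fix \<tau> assume "\<tau> \<in> T"
        from R(2)[OF this, of z] \<open>\<beta> > 0\<close> have "\<beta> * (\<Sum>k\<in>I. c \<tau> k * z k) \<le> \<beta> * R z" by simp
        then show "(\<Sum>k\<in>I. w (pi / 2) \<tau> k * z k) \<le> \<beta> * R z"
          by (simp add: w_def sum_distrib_left mult_ac)
      qed
    qed
    also have "\<dots> = ln (card T) + \<beta> * (\<integral>z. R z \<partial>P I \<sigma>)"
      using R by (simp add: prob_space)
    finally show ?thesis .
  qed
  have ln0: "ln (card T) \<ge> 0"
    using T by (simp add: Suc_leI card_gt_0_iff)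
  show ?thesis
  proof (rule field_le_epsilon)
    fix e :: real assume "e > 0"
    \<comment> \<open>Large enough for \<open>ln (card T) \<le> \<beta> * e\<close>; the summand 1
      keeps \<beta> positive when \<open>T\<close> is a singleton.\<close>
    define \<beta> where "\<beta> = (ln (card T) + 1) / e"
    have "\<beta> > 0" using \<open>e > 0\<close> ln0 by (auto simp: \<beta>_def)
    have "ln (card T) \<le> \<beta> * e" using \<open>e > 0\<close> by (simp add: \<beta>_def)
    with main[OF \<open>\<beta> > 0\<close>] have "\<beta> * ?M \<le> \<beta> * ((\<integral>z. R z \<partial>P I \<sigma>) + e)"
      by (simp add: distrib_left)
    then show "?M \<le> (\<integral>z. R z \<partial>P I \<sigma>) + e" using \<open>\<beta> > 0\<close> by simp
  qed
qed

subsection \<open>The operator norm of a Gaussian matrix\<close>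

lemma expectation_L2_set_le:
  assumes \<sigma>: "\<sigma> \<ge> 0" and J: "J \<subseteq> I" "finite J"
  shows "integrable (PiM I (\<lambda>_. gaussian_measure 0 \<sigma>)) (\<lambda>z. L2_set z J)"
    "(\<integral>z. L2_set z J \<partial>PiM I (\<lambda>_. gaussian_measure 0 \<sigma>)) \<le> sqrt (card J) * \<sigma>"
proof -
  let ?P = "PiM I (\<lambda>_. gaussian_measure 0 \<sigma>)"
  interpret prob_space ?P
    using prob_space_gaussian_measure[OF \<sigma>] by (intro prob_space_PiM)
  have m: "(\<lambda>z. L2_set z J) \<in> borel_measurable ?P"
  proof -
    have "(\<lambda>z. \<Sum>j\<in>J. (z j)\<^sup>2) \<in> borel_measurable ?P"
      using J by (intro borel_measurable_sum borel_measurable_power PiM_gaussian_coordinate_measurable) auto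
    then show ?thesis unfolding L2_set_def by measurable
  qed
  have sq: "(L2_set z J)\<^sup>2 = (\<Sum>j\<in>J. (z j)\<^sup>2)" for z :: "'a \<Rightarrow> real"
    unfolding L2_set_def by (simp add: sum_nonneg)
  have i2: "integrable ?P (\<lambda>z. (L2_set z J)\<^sup>2)"
    unfolding sq using J
    by (intro Bochner_Integration.integrable_sum PiM_gaussian_coordinate_moments(2) \<sigma>) auto
  have v2: "(\<integral>z. (L2_set z J)\<^sup>2 \<partial>?P) = card J * \<sigma>\<^sup>2"
    unfolding sq using J PiM_gaussian_coordinate_moments[OF \<sigma>, of _ I]
    by (subst Bochner_Integration.integral_sum) (auto simp: subset_iff)
  show i: "integrable ?P (\<lambda>z. L2_set z J)"
    by (rule square_integrable_imp_integrable[OF m i2])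
  \<comment> \<open>Nonnegativity of the variance bounds the squared mean by the mean
    square.\<close>
  have "(\<integral>z. L2_set z J \<partial>?P)\<^sup>2 \<le> card J * \<sigma>\<^sup>2"
    using variance_positive[of "\<lambda>z. L2_set z J"] variance_eq[OF i i2] by (simp add: v2)
  also have "\<dots> = (sqrt (card J) * \<sigma>)\<^sup>2"
    by (simp add: power_mult_distrib)
  finally show "(\<integral>z. L2_set z J \<partial>?P) \<le> sqrt (card J) * \<sigma>"
    by (rule power2_le_imp_le) (use \<sigma> in simp)
qed

text \<open>The matrix is given as a function on index pairs, so that a sample point of a product
  measure can be inserted directly.\<close>

definition bilinear_form :: "nat \<Rightarrow> nat \<Rightarrow> (nat \<times> nat \<Rightarrow> real) \<Rightarrow> (nat \<Rightarrow> real) \<Rightarrow> (nat \<Rightarrow> real) \<Rightarrow> real" where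
  "bilinear_form m n a u v = (\<Sum>(i, k)\<in>{..<m} \<times> {..<n}. u i * v k * a (i, k))"

lemma sum_bordered:
  fixes f :: "nat \<times> nat \<Rightarrow> real"
  shows "(\<Sum>p\<in>{..m} \<times> {..n}. f p) = f (0, 0) + (\<Sum>i<m. f (Suc i, 0)) + (\<Sum>k<n. f (0, Suc k))
    + (\<Sum>(i, k)\<in>{..<m} \<times> {..<n}. f (Suc i, Suc k))"
proof -
  have "(\<Sum>p\<in>{..m} \<times> {..n}. f p) = (\<Sum>i\<le>m. \<Sum>k\<le>n. f (i, k))"
    by (simp add: sum.cartesian_product)
  also have "\<dots> = f (0, 0) + (\<Sum>i<m. f (Suc i, 0)) + (\<Sum>k<n. f (0, Suc k))
    + (\<Sum>i<m. \<Sum>k<n. f (Suc i, Suc k))"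
    by (simp add: sum.atMost_shift sum.distrib)
  finally show ?thesis by (simp add: sum.cartesian_product)
qed

lemma sum_diff_squared:
  fixes u v :: "'i \<Rightarrow> real"
  shows "(\<Sum>i\<in>A. (u i - v i)\<^sup>2) = (\<Sum>i\<in>A. (u i)\<^sup>2) + (\<Sum>i\<in>A. (v i)\<^sup>2) - 2 * (\<Sum>i\<in>A. u i * v i)"
  by (simp add: power2_diff sum.distrib sum_subtractf sum_distrib_left mult.assoc)

text \<open>With the inner products \<alpha> of \<open>u\<close>, \<open>u'\<close> and \<beta> of
  \<open>v\<close>, \<open>v'\<close>, the left side is \<open>2 - 2 * \<alpha> * \<beta>\<close>
  and the right side is \<open>4 - 2 * \<alpha> - 2 * \<beta>\<close>. They differ by
  \<open>2 * (1 - \<alpha>) * (1 - \<beta>)\<close>, and inner products of unit vectors are at most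
  1.\<close>

lemma tensor_increment_le:
  fixes u u' v v' :: "nat \<Rightarrow> real"
  assumes "(\<Sum>i<m. (u i)\<^sup>2) = 1" "(\<Sum>i<m. (u' i)\<^sup>2) = 1" "(\<Sum>k<n. (v k)\<^sup>2) = 1" "(\<Sum>k<n. (v' k)\<^sup>2) = 1"
  shows "(\<Sum>(i, k)\<in>{..<m} \<times> {..<n}. (u i * v k - u' i * v' k)\<^sup>2)
    \<le> (\<Sum>i<m. (u i - u' i)\<^sup>2) + (\<Sum>k<n. (v k - v' k)\<^sup>2)"
proof -
  define \<alpha> where "\<alpha> = (\<Sum>i<m. u i * u' i)"
  define \<beta> where "\<beta> = (\<Sum>k<n. v k * v' k)"
  have tensor: "(\<Sum>(i, k)\<in>{..<m} \<times> {..<n}. (f i * g k) * (f' i * g' k)) =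
      (\<Sum>i<m. f i * f' i) * (\<Sum>k<n. g k * g' k)" for f g f' g' :: "nat \<Rightarrow> real"
    by (simp add: sum_product sum.cartesian_product mult_ac)
  have u: "(\<Sum>i<m. (u i - u' i)\<^sup>2) = 2 - 2 * \<alpha>" and v: "(\<Sum>k<n. (v k - v' k)\<^sup>2) = 2 - 2 * \<beta>"
    unfolding sum_diff_squared \<alpha>_def \<beta>_def using assms by simp_all
  have "\<alpha> \<le> 1" "\<beta> \<le> 1"
    using sum_nonneg[of "{..<m}" "\<lambda>i. (u i - u' i)\<^sup>2"] sum_nonneg[of "{..<n}" "\<lambda>k. (v k - v' k)\<^sup>2"]
    by (simp_all add: u v)
  then have "(1 - \<alpha>) * (1 - \<beta>) \<ge> 0" by simp
  moreover have "(\<Sum>(i, k)\<in>{..<m} \<times> {..<n}. (u i * v k - u' i * v' k)\<^sup>2) = 2 - 2 * (\<alpha> * \<beta>)"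
    using sum_diff_squared[of "\<lambda>p. u (fst p) * v (snd p)" "\<lambda>p. u' (fst p) * v' (snd p)" "{..<m} \<times> {..<n}"]
      tensor[of u v u v] tensor[of u' v' u' v'] tensor[of u v u' v'] assms
    by (simp add: case_prod_beta \<alpha>_def \<beta>_def power2_eq_square)
  ultimately show ?thesis
    unfolding u v by (simp add: algebra_simps)
qed

lemma sum_mult_le_L2_set:
  fixes u z :: "'i \<Rightarrow> real"
  assumes "(\<Sum>i\<in>A. (u i)\<^sup>2) = 1"
  shows "(\<Sum>i\<in>A. u i * z i) \<le> L2_set z A"
proof -
  have "(\<Sum>i\<in>A. u i * z i) \<le> (\<Sum>i\<in>A. \<bar>u i\<bar> * \<bar>z i\<bar>)"
    by (intro sum_mono) (metis abs_ge_self abs_mult)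
  also have "\<dots> \<le> L2_set u A * L2_set z A" by (rule L2_set_mult_ineq)
  finally show ?thesis using assms by (simp add: L2_set_def)
qed

text \<open>
  The Gaussian matrix is compared with its border: the tensor process lives on the entries
  (Suc i, Suc k) of an (m+1) by (n+1) Gaussian matrix, the decoupled process on row and column 0.
\<close>

lemma expectation_Max_bilinear_form_le:
  assumes \<sigma>: "\<sigma> \<ge> 0" and T: "finite T" "T \<noteq> {}"
    and unit: "\<And>u v. (u, v) \<in> T \<Longrightarrow> (\<Sum>i<m. (u i)\<^sup>2) = 1 \<and> (\<Sum>k<n. (v k)\<^sup>2) = 1"
  shows "(\<integral>z. (MAX (u, v)\<in>T. bilinear_form m n z u v) \<partial>PiM ({..<m} \<times> {..<n}) (\<lambda>_. gaussian_measure 0 \<sigma>))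
    \<le> (sqrt m + sqrt n) * \<sigma>"
proof -
  let ?K = "{..m} \<times> {..n}" and ?J = "{..<m} \<times> {..<n}"
  let ?P = "\<lambda>I. PiM I (\<lambda>_ :: nat \<times> nat. gaussian_measure 0 \<sigma>)"
  let ?t = "map_prod Suc Suc"
  \<comment> \<open>The supports of \<open>a\<close> (interior) and \<open>c\<close> (border) are
    disjoint, as the comparison requires; both coefficients are 0 at the corner
    \<open>(0, 0)\<close>.\<close>
  define a :: "(nat \<Rightarrow> real) \<times> (nat \<Rightarrow> real) \<Rightarrow> nat \<times> nat \<Rightarrow> real" where
    "a = (\<lambda>(u, v) (i, k). case i of 0 \<Rightarrow> 0 | Suc i \<Rightarrow> (case k of 0 \<Rightarrow> 0 | Suc k \<Rightarrow> u i * v k))"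
  define c :: "(nat \<Rightarrow> real) \<times> (nat \<Rightarrow> real) \<Rightarrow> nat \<times> nat \<Rightarrow> real" where
    "c = (\<lambda>(u, v) (i, k). case i of 0 \<Rightarrow> (case k of 0 \<Rightarrow> 0 | Suc k \<Rightarrow> v k)
       | Suc i \<Rightarrow> (case k of 0 \<Rightarrow> u i | Suc k \<Rightarrow> 0))"
  let ?rows = "(\<lambda>i. (Suc i, 0)) ` {..<m}" and ?cols = "(\<lambda>k. (0, Suc k)) ` {..<n}"
  interpret product_prob_space "\<lambda>_ :: nat \<times> nat. gaussian_measure 0 \<sigma>"
    by (rule product_prob_space_gaussian[OF \<sigma>])
  have rows: "L2_set z ?rows = L2_set (\<lambda>i. z (Suc i, 0)) {..<m}"
    and cols: "L2_set z ?cols = L2_set (\<lambda>k. z (0, Suc k)) {..<n}" for z :: "nat \<times> nat \<Rightarrow> real"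
    unfolding L2_set_def by (subst sum.reindex; simp add: inj_on_def)+
  have border: "?rows \<subseteq> ?K" "?cols \<subseteq> ?K" by auto
  have cards: "card ?rows = m" "card ?cols = n"
    by (subst card_image; simp add: inj_on_def)+
  \<comment> \<open>The interior block, reindexed by the injective shift, is again a Gaussian matrix
    with the original index set, so the expectation can be moved to the bordered matrix.\<close>
  have reorder: "distr (?P ?K) (?P ?J) (\<lambda>\<omega>. \<lambda>p\<in>?J. \<omega> (?t p)) = ?P ?J"
    by (rule distr_reorder) (auto simp: inj_on_def)
  have t_meas: "(\<lambda>\<omega>. \<lambda>p\<in>?J. \<omega> (?t p)) \<in> measurable (?P ?K) (?P ?J)"
    by (rule measurable_restrict) (auto intro!: measurable_component_singleton)
  have max_int: "integrable (?P ?J) (\<lambda>z. MAX (u, v)\<in>T. bilinear_form m n z u v)"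
  proof -
    have "(\<lambda>z. MAX (u, v)\<in>T. bilinear_form m n z u v) =
      (\<lambda>z. MAX \<tau>\<in>T. \<Sum>p\<in>?J. (fst \<tau> (fst p) * snd \<tau> (snd p)) * z p)"
      by (simp add: bilinear_form_def case_prod_beta)
    then show ?thesis
      using Max_linear_forms_integrable[OF \<sigma> _ T, of ?J "\<lambda>\<tau> p. fst \<tau> (fst p) * snd \<tau> (snd p)"] by simp
  qed
  have tensor: "bilinear_form m n (\<lambda>p\<in>?J. z (?t p)) u v = (\<Sum>p\<in>?K. a (u, v) p * z p)" for z u v
    unfolding sum_bordered bilinear_form_def a_def by (auto intro!: sum.cong)
  have "(\<integral>z. (MAX (u, v)\<in>T. bilinear_form m n z u v) \<partial>?P ?J) =
    (\<integral>z. (MAX \<tau>\<in>T. \<Sum>p\<in>?K. a \<tau> p * z p) \<partial>?P ?K)"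
    unfolding tensor[symmetric] case_prod_beta
    by (subst reorder[symmetric], subst integral_distr[OF t_meas])
       (use max_int in \<open>auto simp: case_prod_beta tensor\<close>)
  also have "\<dots> \<le> (\<integral>z. L2_set z ?rows + L2_set z ?cols \<partial>?P ?K)"
  proof (rule Sudakov_Fernique[OF \<sigma> _ T])
    show "a \<tau> p * c \<rho> p = 0" if "p \<in> ?K" for \<tau> \<rho> p
      by (auto simp: a_def c_def case_prod_beta split: nat.split)
    show "(\<Sum>p\<in>?K. (a \<tau> p - a \<rho> p)\<^sup>2) \<le> (\<Sum>p\<in>?K. (c \<tau> p - c \<rho> p)\<^sup>2)" if "\<tau> \<in> T" "\<rho> \<in> T" for \<tau> \<rho>
    proof -
      obtain u v u' v' where uv: "\<tau> = (u, v)" "\<rho> = (u', v')" by fastforce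
      show ?thesis
        using tensor_increment_le[of u m u' v n v'] unit that
        unfolding sum_bordered uv by (simp add: a_def c_def)
    qed
    show "integrable (?P ?K) (\<lambda>z. L2_set z ?rows + L2_set z ?cols)"
      by (intro Bochner_Integration.integrable_add expectation_L2_set_le(1) \<sigma>) auto
    show "(\<Sum>p\<in>?K. c \<tau> p * z p) \<le> L2_set z ?rows + L2_set z ?cols" if "\<tau> \<in> T" for z \<tau>
    proof -
      obtain u v where uv: "\<tau> = (u, v)" by fastforce
      show ?thesis
        using add_mono[OF sum_mult_le_L2_set[of u "{..<m}" "\<lambda>i. z (Suc i, 0)"]
            sum_mult_le_L2_set[of v "{..<n}" "\<lambda>k. z (0, Suc k)"]] unit that
        unfolding sum_bordered uv rows cols by (simp add: c_def)
    qed
  qed simp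
  also have "\<dots> = (\<integral>z. L2_set z ?rows \<partial>?P ?K) + (\<integral>z. L2_set z ?cols \<partial>?P ?K)"
    by (intro Bochner_Integration.integral_add expectation_L2_set_le(1) \<sigma>) auto
  also have "\<dots> \<le> sqrt m * \<sigma> + sqrt n * \<sigma>"
    using expectation_L2_set_le(2)[OF \<sigma> border(1)] expectation_L2_set_le(2)[OF \<sigma> border(2)]
    unfolding cards by (intro add_mono) auto
  finally show ?thesis by (simp add: distrib_right)
qed

section \<open>The operator norm as a countable supremum\<close>

definition rational_directions :: "nat \<Rightarrow> (nat \<Rightarrow> real) set" where
  "rational_directions m =
     (\<lambda>p i. p i / L2_set p {..<m}) ` {p \<in> {..<m} \<rightarrow>\<^sub>E \<rat>. L2_set p {..<m} \<noteq> 0}"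

text \<open>
  The operator norm of an m by n matrix, as a supremum over a countable set so that it is
  visibly measurable.
\<close>

definition operator_norm :: "nat \<Rightarrow> nat \<Rightarrow> (nat \<times> nat \<Rightarrow> real) \<Rightarrow> real" where
  "operator_norm m n a =
     (SUP (u, v)\<in>rational_directions m \<times> rational_directions n. bilinear_form m n a u v)"

text \<open>Holds because the rational points are taken as extensional functions on a finite set;
  unrestricted functions on the naturals would not be countable.\<close>

lemma countable_rational_directions: "countable (rational_directions m)"
  unfolding rational_directions_def
  by (intro countable_image countable_subset[OF Collect_subset] countable_PiE)
     (auto simp: countable_rat)

lemma rational_directions_nonempty:
  assumes "m > 0"
  shows "rational_directions m \<noteq> {}"
proof -
  have "L2_set (\<lambda>i\<in>{..<m}. 1) {..<m} \<noteq> 0"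
    using assms by (simp add: L2_set_def)
  then have "(\<lambda>i\<in>{..<m}. 1) \<in> {p \<in> {..<m} \<rightarrow>\<^sub>E \<rat>. L2_set p {..<m} \<noteq> 0}"
    by (simp add: restrict_PiE_iff)
  then show ?thesis
    unfolding rational_directions_def by blast
qed

lemma rational_directions_unit:
  assumes "u \<in> rational_directions m"
  shows "(\<Sum>i<m. (u i)\<^sup>2) = 1"
proof -
  obtain p where p: "u = (\<lambda>i. p i / L2_set p {..<m})" "L2_set p {..<m} \<noteq> 0"
    using assms by (auto simp: rational_directions_def)
  have "(\<Sum>i<m. (u i)\<^sup>2) = (\<Sum>i<m. (p i)\<^sup>2) / (L2_set p {..<m})\<^sup>2"
    unfolding p by (simp add: power_divide sum_divide_distrib)
  also have "(L2_set p {..<m})\<^sup>2 = (\<Sum>i<m. (p i)\<^sup>2)"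
    by (simp add: L2_set_def sum_nonneg)
  finally show ?thesis using p(2) by (simp add: L2_set_def)
qed

lemma abs_le_1_if_unit:
  fixes u :: "nat \<Rightarrow> real"
  assumes "(\<Sum>i<m. (u i)\<^sup>2) = 1" "i < m"
  shows "\<bar>u i\<bar> \<le> 1"
  using member_le_sum[of i "{..<m}" "\<lambda>i. (u i)\<^sup>2"] assms by (simp add: abs_square_le_1)

text \<open>A crude bound, uniform over unit vectors: it makes the supremum finite and is an
  integrable majorant for dominated convergence.\<close>

lemma abs_bilinear_form_le:
  assumes "(\<Sum>i<m. (u i)\<^sup>2) = 1" "(\<Sum>k<n. (v k)\<^sup>2) = 1"
  shows "\<bar>bilinear_form m n a u v\<bar> \<le> (\<Sum>p\<in>{..<m} \<times> {..<n}. \<bar>a p\<bar>)"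
proof -
  have "\<bar>bilinear_form m n a u v\<bar> \<le> (\<Sum>(i, k)\<in>{..<m} \<times> {..<n}. \<bar>u i * v k * a (i, k)\<bar>)"
    unfolding bilinear_form_def case_prod_beta by (rule sum_abs)
  also have "\<dots> \<le> (\<Sum>p\<in>{..<m} \<times> {..<n}. \<bar>a p\<bar>)"
    using abs_le_1_if_unit[OF assms(1)] abs_le_1_if_unit[OF assms(2)]
    by (intro sum_mono) (auto simp: abs_mult intro!: mult_left_le_one_le mult_le_one)
  finally show ?thesis .
qed

lemma bilinear_form_directions_bdd:
  "bdd_above ((\<lambda>(u, v). bilinear_form m n a u v) ` (rational_directions m \<times> rational_directions n))"
proof (rule bdd_aboveI2)
  fix \<tau> assume "\<tau> \<in> rational_directions m \<times> rational_directions n"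
  then show "(case \<tau> of (u, v) \<Rightarrow> bilinear_form m n a u v) \<le> (\<Sum>p\<in>{..<m} \<times> {..<n}. \<bar>a p\<bar>)"
    using abs_bilinear_form_le[OF rational_directions_unit rational_directions_unit, of "fst \<tau>" m "snd \<tau>" n a]
    by auto
qed

lemma rational_approximation:
  fixes u :: "nat \<Rightarrow> real"
  obtains p where "\<And>N i. p N i \<in> \<rat>" "\<And>i. (\<lambda>N. p N i) \<longlonglongrightarrow> u i"
proof -
  have "\<forall>N i. \<exists>q. q \<in> \<rat> \<and> u i < q \<and> q < u i + 1 / real (Suc N)"
    using Rats_dense_in_real by (metis less_add_same_cancel1 of_nat_0_less_iff zero_less_Suc zero_less_divide_1_iff)
  then obtain p where "\<forall>N i. p N i \<in> \<rat> \<and> u i < p N i \<and> p N i < u i + 1 / real (Suc N)"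
    by metis
  then have p: "\<And>N i. p N i \<in> \<rat>" "\<And>N i. u i < p N i" "\<And>N i. p N i < u i + 1 / real (Suc N)"
    by auto
  have "(\<lambda>N. p N i) \<longlonglongrightarrow> u i" for i
  proof (rule tendsto_sandwich[OF _ _ tendsto_const])
    show "(\<lambda>N. u i + 1 / real (Suc N)) \<longlonglongrightarrow> u i"
      using tendsto_add[OF tendsto_const LIMSEQ_Suc[OF lim_1_over_n], of "u i"] by simp
  qed (use p in \<open>auto intro!: always_eventually less_imp_le\<close>)
  with p(1) show thesis using that by blast
qed

text \<open>Nonzero rational vectors are multiples of rational directions, so homogeneity settles
  them; arbitrary real vectors follow because both sides are continuous in the coordinates.\<close>

lemma bilinear_form_le_operator_norm:
  "bilinear_form m n a u v \<le> operator_norm m n a * (L2_set u {..<m} * L2_set v {..<n})"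
proof -
  have rat: "bilinear_form m n a p q \<le> operator_norm m n a * (L2_set p {..<m} * L2_set q {..<n})"
    if pq: "\<And>i. p i \<in> \<rat>" "\<And>k. q k \<in> \<rat>" for p q
  proof (cases "L2_set p {..<m} = 0 \<or> L2_set q {..<n} = 0")
    case True
    then have "(\<forall>i<m. p i = 0) \<or> (\<forall>k<n. q k = 0)"
      by (auto simp: L2_set_eq_0_iff)
    then have "bilinear_form m n a p q = 0"
      by (auto simp: bilinear_form_def intro!: sum.neutral)
    with True show ?thesis by auto
  next
    case False
    define u where "u i = restrict p {..<m} i / L2_set p {..<m}" for i
    define v where "v k = restrict q {..<n} k / L2_set q {..<n}" for k
    have r: "L2_set (restrict p {..<m}) {..<m} = L2_set p {..<m}" "L2_set (restrict q {..<n}) {..<n} = L2_set q {..<n}"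
      by (auto intro: L2_set_cong)
    have "u \<in> rational_directions m"
      unfolding rational_directions_def using pq False r u_def[abs_def]
      by (intro image_eqI[of _ _ "restrict p {..<m}"]) auto
    moreover have "v \<in> rational_directions n"
      unfolding rational_directions_def using pq False r v_def[abs_def]
      by (intro image_eqI[of _ _ "restrict q {..<n}"]) auto
    ultimately have "bilinear_form m n a u v \<le> operator_norm m n a"
      unfolding operator_norm_def
      using cSUP_upper[OF _ bilinear_form_directions_bdd, where x = "(u, v)"] by fastforce
    moreover have "bilinear_form m n a p q = bilinear_form m n a u v * (L2_set p {..<m} * L2_set q {..<n})"
      using False unfolding bilinear_form_def sum_distrib_right by (intro sum.cong) (auto simp: u_def v_def)
    ultimately show ?thesis by (simp add: mult_right_mono)
  qed
  obtain p where p: "\<And>N i. p N i \<in> \<rat>" "\<And>i. (\<lambda>N. p N i) \<longlonglongrightarrow> u i"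
    using rational_approximation[of u] by blast
  obtain q where q: "\<And>N i. q N i \<in> \<rat>" "\<And>i. (\<lambda>N. q N i) \<longlonglongrightarrow> v i"
    using rational_approximation[of v] by blast
  show ?thesis
  proof (rule LIMSEQ_le)
    show "(\<lambda>N. bilinear_form m n a (p N) (q N)) \<longlonglongrightarrow> bilinear_form m n a u v"
      unfolding bilinear_form_def case_prod_beta by (intro tendsto_intros p q)
    show "(\<lambda>N. operator_norm m n a * (L2_set (p N) {..<m} * L2_set (q N) {..<n}))
      \<longlonglongrightarrow> operator_norm m n a * (L2_set u {..<m} * L2_set v {..<n})"
      unfolding L2_set_def by (intro tendsto_intros p q)
  qed (use rat p q in blast)
qed

text \<open>Replacing \<open>u\<close> by its negative changes the sign of the form. The inequality
  for arbitrary vectors is used, which avoids having to show that the negative is again a rational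
  direction.\<close>

lemma operator_norm_nonneg:
  assumes "m > 0" "n > 0"
  shows "operator_norm m n a \<ge> 0"
proof -
  obtain u v where uv: "u \<in> rational_directions m" "v \<in> rational_directions n"
    using rational_directions_nonempty assms by blast
  have "L2_set u {..<m} = 1" "L2_set v {..<n} = 1" "L2_set (\<lambda>i. - u i) {..<m} = 1"
    using rational_directions_unit[OF uv(1)] rational_directions_unit[OF uv(2)] by (simp_all add: L2_set_def)
  then have "bilinear_form m n a u v \<le> operator_norm m n a" "- bilinear_form m n a u v \<le> operator_norm m n a"
    using bilinear_form_le_operator_norm[of m n a u v] bilinear_form_le_operator_norm[of m n a "\<lambda>i. - u i" v]
    by (simp_all add: bilinear_form_def case_prod_beta sum_negf)
  then show ?thesis by linarith
qed

lemma operator_norm_measurable: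
  "operator_norm m n \<in> borel_measurable (PiM ({..<m} \<times> {..<n}) (\<lambda>_. borel))"
  unfolding operator_norm_def
proof (rule borel_measurable_cSUP)
  show "countable (rational_directions m \<times> rational_directions n)"
    by (intro countable_SIGMA countable_rational_directions)
  show "(\<lambda>a. case \<tau> of (u, v) \<Rightarrow> bilinear_form m n a u v) \<in> borel_measurable (PiM ({..<m} \<times> {..<n}) (\<lambda>_. borel))" for \<tau>
    unfolding bilinear_form_def case_prod_beta
    by (intro borel_measurable_sum borel_measurable_times borel_measurable_const measurable_component_singleton) auto
qed (rule bilinear_form_directions_bdd)

text \<open>The supremum is the increasing limit of maxima over finite initial segments of an
  enumeration. The finite bound is the same for all segments and passes to the limit by dominated
  convergence.\<close>

lemma operator_norm_expectation:
  assumes \<sigma>: "\<sigma> \<ge> 0" and mn: "m > 0" "n > 0"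
  defines "P \<equiv> PiM ({..<m} \<times> {..<n}) (\<lambda>_. gaussian_measure 0 \<sigma>)"
  shows "integrable P (operator_norm m n)"
    "(\<integral>z. operator_norm m n z \<partial>P) \<le> (sqrt m + sqrt n) * \<sigma>"
proof -
  let ?J = "{..<m} \<times> {..<n}" and ?D = "rational_directions m \<times> rational_directions n"
  let ?B = "\<lambda>z (u, v). bilinear_form m n z u v"
  define e where "e = from_nat_into ?D"
  have D: "countable ?D" "?D \<noteq> {}"
    using mn by (auto intro: countable_rational_directions simp: rational_directions_nonempty)
  have e: "e N \<in> ?D" for N
    unfolding e_def by (rule from_nat_into[OF D(2)])
  define X where "X N z = (MAX \<tau>\<in>e ` {..N}. ?B z \<tau>)" for N z
  have X_in: "\<exists>\<tau>\<in>?D. X N z = ?B z \<tau>" for N z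
  proof -
    have "X N z \<in> ?B z ` e ` {..N}" unfolding X_def by (rule Max_in) auto
    then show ?thesis using e by blast
  qed
  have X_le: "X N z \<le> operator_norm m n z" for N z
  proof -
    obtain \<tau> where \<tau>: "\<tau> \<in> ?D" "X N z = ?B z \<tau>" using X_in by blast
    show ?thesis
      unfolding operator_norm_def \<tau>(2) by (rule cSUP_upper[OF \<tau>(1) bilinear_form_directions_bdd])
  qed
  have X_abs: "\<bar>X N z\<bar> \<le> (\<Sum>p\<in>?J. \<bar>z p\<bar>)" for N z
  proof -
    obtain \<tau> where "\<tau> \<in> ?D" "X N z = ?B z \<tau>" using X_in by blast
    then show ?thesis
      using abs_bilinear_form_le[OF rational_directions_unit rational_directions_unit, of "fst \<tau>" m "snd \<tau>" n z]
      by auto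
  qed
  have X_tendsto: "(\<lambda>N. X N z) \<longlonglongrightarrow> operator_norm m n z" for z
  proof (rule increasing_LIMSEQ)
    show "X N z \<le> X (Suc N) z" for N
      unfolding X_def by (rule Max_mono) auto
    fix \<epsilon> :: real assume "\<epsilon> > 0"
    then have "operator_norm m n z - \<epsilon> < operator_norm m n z" by simp
    \<comment> \<open>A direction within \<epsilon> of the supremum; it occurs in the enumeration at
      some index, from which on the maxima are just as close.\<close>
    then obtain \<tau> where \<tau>: "\<tau> \<in> ?D" "operator_norm m n z - \<epsilon> < ?B z \<tau>"
      unfolding operator_norm_def by (subst (asm) less_cSUP_iff[OF D(2) bilinear_form_directions_bdd]) auto
    obtain N where N: "e N = \<tau>"
      unfolding e_def using from_nat_into_surj[OF D(1) \<tau>(1)] by blast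
    have "?B z \<tau> \<le> X N z"
      unfolding X_def using N by (intro Max_ge) auto
    with \<tau> show "\<exists>N. operator_norm m n z \<le> X N z + \<epsilon>" by (intro exI[of _ N]) linarith
  qed (rule X_le)
  have X_meas: "X N \<in> borel_measurable P" for N
    unfolding X_def bilinear_form_def case_prod_beta P_def
    by (intro borel_measurable_Max borel_measurable_sum borel_measurable_times borel_measurable_const
        PiM_gaussian_coordinate_measurable) auto
  have opn_meas: "operator_norm m n \<in> borel_measurable P"
    by (rule borel_measurable_LIMSEQ_real[OF X_tendsto X_meas])
  have dom: "integrable P (\<lambda>z. \<Sum>p\<in>?J. \<bar>z p\<bar>)"
    unfolding P_def by (intro Bochner_Integration.integrable_sum PiM_gaussian_coordinate_moments(1) \<sigma>) auto
  have dc: "AE z in P. (\<lambda>N. X N z) \<longlonglongrightarrow> operator_norm m n z" "\<And>N. AE z in P. norm (X N z) \<le> (\<Sum>p\<in>?J. \<bar>z p\<bar>)"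
    using X_tendsto X_abs by auto
  show "integrable P (operator_norm m n)"
    by (rule integrable_dominated_convergence[OF opn_meas X_meas dom dc])
  have "(\<lambda>N. \<integral>z. X N z \<partial>P) \<longlonglongrightarrow> (\<integral>z. operator_norm m n z \<partial>P)"
    by (rule integral_dominated_convergence[OF opn_meas X_meas dom dc])
  then show "(\<integral>z. operator_norm m n z \<partial>P) \<le> (sqrt m + sqrt n) * \<sigma>"
  proof (rule LIMSEQ_le_const2, intro exI allI impI)
    fix N
    show "(\<integral>z. X N z \<partial>P) \<le> (sqrt m + sqrt n) * \<sigma>"
      unfolding X_def P_def
    proof (rule expectation_Max_bilinear_form_le[OF \<sigma>])
      fix u v assume "(u, v) \<in> e ` {..N}"
      then have "u \<in> rational_directions m" "v \<in> rational_directions n" using e by (metis imageE mem_Sigma_iff)+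
      then show "(\<Sum>i<m. (u i)\<^sup>2) = 1 \<and> (\<Sum>k<n. (v k)\<^sup>2) = 1"
        by (simp add: rational_directions_unit)
    qed auto
  qed
qed

subsection \<open>Lipschitz constants of networks\<close>

lemma vec_norm2_nonneg: "vec_norm2 x \<ge> 0"
  by (simp add: vec_norm2_def L2_set_nonneg)

lemma vec_norm2_diff:
  assumes "x \<in> carrier_vec d" "y \<in> carrier_vec d"
  shows "vec_norm2 (x - y) = L2_set (\<lambda>i. x $ i - y $ i) {..<d}"
  unfolding vec_norm2_def using assms by (auto intro!: L2_set_cong)

lemma vec_norm2_diff_triangle:
  assumes "x \<in> carrier_vec d" "y \<in> carrier_vec d" "z \<in> carrier_vec d"
  shows "vec_norm2 (x - z) \<le> vec_norm2 (x - y) + vec_norm2 (y - z)"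
  using L2_set_triangle_ineq[of "\<lambda>i. x $ i - y $ i" "\<lambda>i. y $ i - z $ i" "{..<d}"] assms
  by (simp add: vec_norm2_diff)

text \<open>The form is tested at \<open>z\<close> and at the image \<open>v\<close> of
  \<open>z\<close>: its value is the squared norm of \<open>v\<close>, and one factor
  \<open>vec_norm2 v\<close> cancels.\<close>

lemma vec_norm2_transpose_mult_le:
  assumes W: "W \<in> carrier_mat m n" and z: "z \<in> carrier_vec m" and "m > 0" "n > 0"
  shows "vec_norm2 (transpose_mat W *\<^sub>v z) \<le> operator_norm m n (\<lambda>p. W $$ p) * vec_norm2 z"
proof -
  define v where "v = transpose_mat W *\<^sub>v z"
  have v: "v \<in> carrier_vec n" using W by (simp add: v_def mult_mat_vec_carrier[of _ n m] z)
  have vk: "v $ k = (\<Sum>i<m. W $$ (i, k) * z $ i)" if "k < n" for k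
    using W z that by (simp add: v_def scalar_prod_def lessThan_atLeast0)
  have norm_v: "vec_norm2 v = L2_set (\<lambda>k. v $ k) {..<n}" and norm_z: "vec_norm2 z = L2_set (\<lambda>i. z $ i) {..<m}"
    using v z by (simp_all add: vec_norm2_def)
  have "(vec_norm2 v)\<^sup>2 = (\<Sum>k<n. v $ k * v $ k)"
    by (simp add: norm_v L2_set_def sum_nonneg power2_eq_square[symmetric])
  also have "\<dots> = (\<Sum>k<n. \<Sum>i<m. z $ i * v $ k * W $$ (i, k))"
    by (rule sum.cong[OF refl], subst (2) vk) (simp_all add: sum_distrib_left mult_ac)
  also have "\<dots> = bilinear_form m n (\<lambda>p. W $$ p) (\<lambda>i. z $ i) (\<lambda>k. v $ k)"
    unfolding bilinear_form_def by (subst sum.swap) (simp add: sum.cartesian_product)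
  also have "\<dots> \<le> operator_norm m n (\<lambda>p. W $$ p) * (vec_norm2 z * vec_norm2 v)"
    unfolding norm_v norm_z by (rule bilinear_form_le_operator_norm)
  finally have *: "vec_norm2 v * vec_norm2 v \<le> (operator_norm m n (\<lambda>p. W $$ p) * vec_norm2 z) * vec_norm2 v"
    by (simp add: power2_eq_square mult_ac)
  show ?thesis
  proof (cases "vec_norm2 v = 0")
    case True
    then show ?thesis
      using operator_norm_nonneg[OF assms(3,4)] vec_norm2_nonneg by (simp flip: v_def)
  next
    case False
    then have "vec_norm2 v > 0" using vec_norm2_nonneg[of v] by simp
    with * show ?thesis by (simp flip: v_def)
  qed
qed

text \<open>Links the entries of an actual weight matrix with points of a product space, which are
  extensional functions.\<close>

lemma operator_norm_restrict:
  "operator_norm m n (restrict a ({..<m} \<times> {..<n})) = operator_norm m n a"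
proof -
  have "bilinear_form m n (restrict a ({..<m} \<times> {..<n})) = bilinear_form m n a"
    by (auto simp: bilinear_form_def fun_eq_iff intro!: sum.cong)
  then show ?thesis by (simp add: operator_norm_def)
qed

text \<open>A vector sum takes its dimension from the second summand, here the bias.\<close>

lemma affine_layer_carrier: "c \<in> carrier_vec d \<Longrightarrow> affine_layer W c z \<in> carrier_vec d"
  unfolding affine_layer_def by (metis carrier_vecD carrier_vecI index_add_vec(2))

lemma network_carrier:
  assumes "\<And>i. i \<in> {1..j} \<Longrightarrow> b i \<in> carrier_vec (h i)" and "x \<in> carrier_vec (h 0)"
  shows "network \<phi> W b j x \<in> carrier_vec (h j)"
  using assms
proof (induction j)
  case (Suc j)
  have "b (Suc j) \<in> carrier_vec (h (Suc j))"
    using Suc.prems(1)[of "Suc j"] by simp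
  then show ?case by (simp add: affine_layer_carrier)
qed simp

lemma network_Suc_index:
  assumes "\<And>i. i \<in> {1..Suc j} \<Longrightarrow> W i \<in> carrier_mat (h (i - 1)) (h i)"
    and "\<And>i. i \<in> {1..Suc j} \<Longrightarrow> b i \<in> carrier_vec (h i)" and "x \<in> carrier_vec (h 0)"
    and "k < h (Suc j)"
  shows "network \<phi> W b (Suc j) x $ k =
    \<phi> (Suc j) ((\<Sum>i<h j. W (Suc j) $$ (i, k) * network \<phi> W b j x $ i) + b (Suc j) $ k)"
proof -
  have W: "W (Suc j) \<in> carrier_mat (h j) (h (Suc j))" and b: "b (Suc j) \<in> carrier_vec (h (Suc j))"
    using assms(1)[of "Suc j"] assms(2)[of "Suc j"] by auto
  have "network \<phi> W b j x \<in> carrier_vec (h j)"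
    using assms(2,3) by (intro network_carrier[where h = h]) auto
  with W b assms(4) show ?thesis
    by (simp add: affine_layer_def scalar_prod_def lessThan_atLeast0)
qed

lemma network_lipschitz:
  assumes "\<And>i. i \<in> {1..j} \<Longrightarrow> W i \<in> carrier_mat (h (i - 1)) (h i)"
    and "\<And>i. i \<in> {1..j} \<Longrightarrow> b i \<in> carrier_vec (h i)"
    and "\<And>i. i \<in> {1..j} \<Longrightarrow> 1-lipschitz_on UNIV (\<phi> i)"
    and "\<And>i. i \<le> j \<Longrightarrow> h i > 0"
    and x: "x \<in> carrier_vec (h 0)" "x' \<in> carrier_vec (h 0)"
  shows "vec_norm2 (network \<phi> W b j x - network \<phi> W b j x') \<le>
    (\<Prod>i=1..j. operator_norm (h (i - 1)) (h i) (\<lambda>p. W i $$ p)) * vec_norm2 (x - x')"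
  using assms(1-4)
proof (induction j)
  case (Suc j)
  let ?y = "network \<phi> W b j x" and ?y' = "network \<phi> W b j x'"
  let ?A = "affine_layer (W (Suc j)) (b (Suc j))"
  let ?N = "operator_norm (h j) (h (Suc j)) (\<lambda>p. W (Suc j) $$ p)"
  have W: "W (Suc j) \<in> carrier_mat (h j) (h (Suc j))" and b: "b (Suc j) \<in> carrier_vec (h (Suc j))"
    and \<phi>: "1-lipschitz_on UNIV (\<phi> (Suc j))" and h: "h j > 0" "h (Suc j) > 0"
    using Suc.prems(1)[of "Suc j"] Suc.prems(2)[of "Suc j"] Suc.prems(3)[of "Suc j"]
      Suc.prems(4)[of j] Suc.prems(4)[of "Suc j"] by auto
  have y: "?y \<in> carrier_vec (h j)" "?y' \<in> carrier_vec (h j)"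
    using Suc.prems(2) x by (auto intro!: network_carrier[where h = h])
  have A: "?A z \<in> carrier_vec (h (Suc j))" for z
    using b by (rule affine_layer_carrier)
  have "vec_norm2 (network \<phi> W b (Suc j) x - network \<phi> W b (Suc j) x') \<le> vec_norm2 (?A ?y - ?A ?y')"
  proof -
    have "\<bar>\<phi> (Suc j) s - \<phi> (Suc j) t\<bar> \<le> \<bar>s - t\<bar>" for s t
      using lipschitz_onD[OF \<phi>, of s t] by (simp add: dist_real_def)
    then have "(\<phi> (Suc j) s - \<phi> (Suc j) t)\<^sup>2 \<le> (s - t)\<^sup>2" for s t
      by (simp add: abs_le_square_iff)
    then show ?thesis
      using A[of ?y] A[of ?y'] by (simp add: vec_norm2_diff[of _ "h (Suc j)"] L2_set_def sum_mono)
  qed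
  \<comment> \<open>The biases cancel.\<close>
  also have "?A ?y - ?A ?y' = transpose_mat (W (Suc j)) *\<^sub>v (?y - ?y')"
  proof -
    have "?A ?y - ?A ?y' = transpose_mat (W (Suc j)) *\<^sub>v ?y - transpose_mat (W (Suc j)) *\<^sub>v ?y'"
      unfolding affine_layer_def using W b by (intro eq_vecI) auto
    also have "\<dots> = transpose_mat (W (Suc j)) *\<^sub>v (?y - ?y')"
      using W y by (intro mult_minus_distrib_mat_vec[symmetric]) auto
    finally show ?thesis .
  qed
  also have "vec_norm2 (transpose_mat (W (Suc j)) *\<^sub>v (?y - ?y')) \<le> ?N * vec_norm2 (?y - ?y')"
    using W y h by (intro vec_norm2_transpose_mult_le) auto
  also have "\<dots> \<le> ?N * ((\<Prod>i=1..j. operator_norm (h (i - 1)) (h i) (\<lambda>p. W i $$ p)) * vec_norm2 (x - x'))"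
    using Suc.prems by (intro mult_left_mono Suc.IH operator_norm_nonneg h) auto
  also have "\<dots> = (\<Prod>i=1..Suc j. operator_norm (h (i - 1)) (h i) (\<lambda>p. W i $$ p)) * vec_norm2 (x - x')"
    by (simp add: mult_ac)
  finally show ?case .
qed simp

section \<open>The Lipschitz constant as a measurable function\<close>

context
  fixes d :: nat and f :: "rvec \<Rightarrow> rvec" and K :: real
  assumes lipschitz: "\<And>x x'. \<lbrakk>x \<in> carrier_vec d; x' \<in> carrier_vec d\<rbrakk> \<Longrightarrow> vec_norm2 (f x - f x') \<le> K * vec_norm2 (x - x')"
    and K: "K \<ge> 0"
begin

text \<open>\<open>LEAST\<close> on the reals says something only if a minimum is attained. The
  admissible set is nonempty because of \<open>K\<close>, and its infimum is shown to be
  admissible.\<close>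

lemma lipschitz_const_le_iff:
  "lipschitz_const d f \<le> c \<longleftrightarrow>
    0 \<le> c \<and> (\<forall>x\<in>carrier_vec d. \<forall>x'\<in>carrier_vec d. vec_norm2 (f x - f x') \<le> c * vec_norm2 (x - x'))"
proof -
  let ?adm = "\<lambda>L. 0 \<le> L \<and> (\<forall>x\<in>carrier_vec d. \<forall>x'\<in>carrier_vec d. vec_norm2 (f x - f x') \<le> L * vec_norm2 (x - x'))"
  define L where "L = Inf (Collect ?adm)"
  have bdd: "bdd_below (Collect ?adm)" by (rule bdd_belowI[of _ 0]) auto
  have ne: "Collect ?adm \<noteq> {}" using lipschitz K by blast
  have lower: "L \<le> c" if "?adm c" for c
    unfolding L_def using bdd that by (intro cInf_lower) auto
  have L: "?adm L"
  proof (intro conjI ballI)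
    show "0 \<le> L" unfolding L_def using ne by (intro cInf_greatest) auto
    fix x x' :: rvec assume x: "x \<in> carrier_vec d" "x' \<in> carrier_vec d"
    show "vec_norm2 (f x - f x') \<le> L * vec_norm2 (x - x')"
    proof (cases "vec_norm2 (x - x') = 0")
      \<comment> \<open>The inequality with \<open>K\<close> forces the left side to be at most
        0.\<close>
      case True
      then show ?thesis using lipschitz[OF x] by simp
    next
      case False
      then have pos: "vec_norm2 (x - x') > 0" using vec_norm2_nonneg[of "x - x'"] by simp
      \<comment> \<open>Every admissible constant is at least this quotient, hence so is the
        infimum.\<close>
      have "vec_norm2 (f x - f x') / vec_norm2 (x - x') \<le> L"
        unfolding L_def using ne pos x by (intro cInf_greatest) (auto simp: divide_le_eq)
      then show ?thesis using pos by (simp add: divide_le_eq)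
    qed
  qed
  have eq: "lipschitz_const d f = L"
    unfolding lipschitz_const_def using L lower by (intro Least_equality) auto
  show ?thesis
  proof
    assume c: "lipschitz_const d f \<le> c"
    then have "vec_norm2 (f x - f x') \<le> c * vec_norm2 (x - x')" if "x \<in> carrier_vec d" "x' \<in> carrier_vec d" for x x'
      using L that eq mult_right_mono[OF c vec_norm2_nonneg, of "x - x'"] by (auto intro: order_trans)
    then show "?adm c" using L c eq by auto
  qed (use lower eq in simp)
qed

lemma lipschitz_const_nonneg: "lipschitz_const d f \<ge> 0"
  using lipschitz_const_le_iff[of "lipschitz_const d f"] by simp

lemma lipschitz_const_le: "lipschitz_const d f \<le> K"
  using lipschitz_const_le_iff[of K] lipschitz K by simp

text \<open>Countably many inequalities decide the sublevel set, which is what measurability needs.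
  They suffice because \<open>f\<close>, being \<open>K\<close>-Lipschitz, is continuous.\<close>

lemma lipschitz_const_le_iff_rational:
  assumes f: "\<And>x. x \<in> carrier_vec d \<Longrightarrow> f x \<in> carrier_vec e"
  shows "lipschitz_const d f \<le> c \<longleftrightarrow> 0 \<le> c \<and> (\<forall>(p, q)\<in>({..<d} \<rightarrow>\<^sub>E \<rat>) \<times> ({..<d} \<rightarrow>\<^sub>E \<rat>).
    vec_norm2 (f (vec d p) - f (vec d q)) \<le> c * vec_norm2 (vec d p - vec d q))" (is "_ \<longleftrightarrow> 0 \<le> c \<and> ?rat")
proof -
  have "vec_norm2 (f x - f x') \<le> c * vec_norm2 (x - x')"
    if rat: ?rat and x: "x \<in> carrier_vec d" "x' \<in> carrier_vec d" for x x'
  proof -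
    obtain p where p: "\<And>N i. p N i \<in> \<rat>" "\<And>i. (\<lambda>N. p N i) \<longlonglongrightarrow> x $ i"
      using rational_approximation[of "\<lambda>i. x $ i"] by blast
    obtain q where q: "\<And>N i. q N i \<in> \<rat>" "\<And>i. (\<lambda>N. q N i) \<longlonglongrightarrow> x' $ i"
      using rational_approximation[of "\<lambda>i. x' $ i"] by blast
    define X where "X N = vec d (p N)" for N
    define X' where "X' N = vec d (q N)" for N
    have X: "X N \<in> carrier_vec d" "X' N \<in> carrier_vec d" for N by (simp_all add: X_def X'_def)
    have lim: "(\<lambda>N. vec_norm2 (x - X N)) \<longlonglongrightarrow> 0" "(\<lambda>N. vec_norm2 (X' N - x')) \<longlonglongrightarrow> 0"
      "(\<lambda>N. vec_norm2 (X N - X' N)) \<longlonglongrightarrow> vec_norm2 (x - x')"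
    proof -
      have "(\<lambda>N. L2_set (\<lambda>i. x $ i - p N i) {..<d}) \<longlonglongrightarrow> L2_set (\<lambda>i. x $ i - x $ i) {..<d}"
        "(\<lambda>N. L2_set (\<lambda>i. q N i - x' $ i) {..<d}) \<longlonglongrightarrow> L2_set (\<lambda>i. x' $ i - x' $ i) {..<d}"
        "(\<lambda>N. L2_set (\<lambda>i. p N i - q N i) {..<d}) \<longlonglongrightarrow> L2_set (\<lambda>i. x $ i - x' $ i) {..<d}"
        unfolding L2_set_def by (intro tendsto_intros p q)+
      moreover have "vec_norm2 (x - X N) = L2_set (\<lambda>i. x $ i - p N i) {..<d}"
        "vec_norm2 (X' N - x') = L2_set (\<lambda>i. q N i - x' $ i) {..<d}"
        "vec_norm2 (X N - X' N) = L2_set (\<lambda>i. p N i - q N i) {..<d}" for N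
        using vec_norm2_diff[OF x(1) X(1)] vec_norm2_diff[OF X(2) x(2)] vec_norm2_diff[OF X(1) X(2)]
        by (auto simp: X_def X'_def intro!: L2_set_cong)
      ultimately show "(\<lambda>N. vec_norm2 (x - X N)) \<longlonglongrightarrow> 0" "(\<lambda>N. vec_norm2 (X' N - x')) \<longlonglongrightarrow> 0"
        "(\<lambda>N. vec_norm2 (X N - X' N)) \<longlonglongrightarrow> vec_norm2 (x - x')"
        by (simp_all add: vec_norm2_diff[OF x] L2_set_def)
    qed
    \<comment> \<open>Detour through \<open>X N\<close> and \<open>X' N\<close>: the a priori
      constant \<open>K\<close> is spent only on the two outer pieces, whose lengths tend to 0, and
      \<open>c\<close> on the rational middle piece.\<close>
    have bound: "vec_norm2 (f x - f x') \<le>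
        K * vec_norm2 (x - X N) + (c * vec_norm2 (X N - X' N) + K * vec_norm2 (X' N - x'))" for N
    proof -
      \<comment> \<open>\<open>vec d\<close> reads only the indices below \<open>d\<close>, so
        passing to extensional functions leaves the points unchanged.\<close>
      have r: "X N = vec d (restrict (p N) {..<d})" "X' N = vec d (restrict (q N) {..<d})"
        by (auto simp: X_def X'_def)
      have "vec_norm2 (f (X N) - f (X' N)) \<le> c * vec_norm2 (X N - X' N)"
        using bspec[OF rat, of "(restrict (p N) {..<d}, restrict (q N) {..<d})"] p(1) q(1) unfolding r
        by (simp add: restrict_PiE_iff)
      moreover have "vec_norm2 (f x - f x') \<le> vec_norm2 (f x - f (X N)) + vec_norm2 (f (X N) - f x')"
        by (rule vec_norm2_diff_triangle) (rule f x X)+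
      moreover have "vec_norm2 (f (X N) - f x') \<le> vec_norm2 (f (X N) - f (X' N)) + vec_norm2 (f (X' N) - f x')"
        by (rule vec_norm2_diff_triangle) (rule f x X)+
      ultimately show ?thesis
        using lipschitz[OF x(1) X(1)[of N]] lipschitz[OF X(2)[of N] x(2)] by linarith
    qed
    have "(\<lambda>N. K * vec_norm2 (x - X N) + (c * vec_norm2 (X N - X' N) + K * vec_norm2 (X' N - x')))
      \<longlonglongrightarrow> K * 0 + (c * vec_norm2 (x - x') + K * 0)"
      by (intro tendsto_intros lim)
    then have "vec_norm2 (f x - f x') \<le> K * 0 + (c * vec_norm2 (x - x') + K * 0)"
      by (rule LIMSEQ_le_const) (use bound in blast)
    then show ?thesis by simp
  qed
  then show ?thesis unfolding lipschitz_const_le_iff by auto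
qed

end

text \<open>For a fixed input, each output coordinate is built from the weights by sums, products
  and activations; the latter are Lipschitz, hence continuous and Borel.\<close>

lemma network_component_measurable:
  fixes M :: "'a measure"
  assumes "\<And>i \<omega>. \<lbrakk>i \<in> {1..j}; \<omega> \<in> space M\<rbrakk> \<Longrightarrow> \<theta> i \<omega> \<in> carrier_mat (h (i - 1)) (h i)"
    and "\<And>i. i \<in> {1..j} \<Longrightarrow> b i \<in> carrier_vec (h i)"
    and "\<And>i. i \<in> {1..j} \<Longrightarrow> 1-lipschitz_on UNIV (\<phi> i)"
    and "\<And>i r k. \<lbrakk>i \<in> {1..j}; r < h (i - 1); k < h i\<rbrakk> \<Longrightarrow> (\<lambda>\<omega>. \<theta> i \<omega> $$ (r, k)) \<in> borel_measurable M"
    and x: "x \<in> carrier_vec (h 0)" and "k < h j"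
  shows "(\<lambda>\<omega>. network \<phi> (\<lambda>j. \<theta> j \<omega>) b j x $ k) \<in> borel_measurable M"
  using assms(1-4,6)
proof (induction j arbitrary: k)
  case (Suc j)
  have \<phi>: "\<phi> (Suc j) \<in> borel_measurable borel"
    using Suc.prems(3)[of "Suc j"] by (intro borel_measurable_continuous_onI lipschitz_on_continuous_on) auto
  have IH: "(\<lambda>\<omega>. network \<phi> (\<lambda>j. \<theta> j \<omega>) b j x $ i) \<in> borel_measurable M" if "i < h j" for i
    using Suc.prems(1-4) that by (intro Suc.IH) auto
  have \<theta>: "(\<lambda>\<omega>. \<theta> (Suc j) \<omega> $$ (i, k)) \<in> borel_measurable M" if "i < h j" for i
    using Suc.prems(4)[of "Suc j" i k] Suc.prems(5) that by simp
  have "(\<lambda>\<omega>. \<phi> (Suc j) ((\<Sum>i<h j. \<theta> (Suc j) \<omega> $$ (i, k) * network \<phi> (\<lambda>j. \<theta> j \<omega>) b j x $ i) + b (Suc j) $ k))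
     \<in> borel_measurable M"
    by (rule measurable_compose[OF _ \<phi>])
       (intro borel_measurable_add borel_measurable_sum borel_measurable_times borel_measurable_const IH \<theta>; simp)
  moreover have "network \<phi> (\<lambda>j. \<theta> j \<omega>) b (Suc j) x $ k =
     \<phi> (Suc j) ((\<Sum>i<h j. \<theta> (Suc j) \<omega> $$ (i, k) * network \<phi> (\<lambda>j. \<theta> j \<omega>) b j x $ i) + b (Suc j) $ k)"
    if "\<omega> \<in> space M" for \<omega>
    using Suc.prems(1,2,5) x that by (intro network_Suc_index) auto
  ultimately show ?case by (subst measurable_cong) auto
qed simp

lemma lipschitz_const_measurable:
  fixes F :: "'a \<Rightarrow> rvec \<Rightarrow> rvec"
  assumes lipschitz: "\<And>\<omega> x x'. \<lbrakk>\<omega> \<in> space M; x \<in> carrier_vec d; x' \<in> carrier_vec d\<rbrakk>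
      \<Longrightarrow> vec_norm2 (F \<omega> x - F \<omega> x') \<le> K \<omega> * vec_norm2 (x - x')"
    and K: "\<And>\<omega>. \<omega> \<in> space M \<Longrightarrow> K \<omega> \<ge> 0"
    and carrier: "\<And>\<omega> x. \<lbrakk>\<omega> \<in> space M; x \<in> carrier_vec d\<rbrakk> \<Longrightarrow> F \<omega> x \<in> carrier_vec e"
    and meas: "\<And>x k. \<lbrakk>x \<in> carrier_vec d; k < e\<rbrakk> \<Longrightarrow> (\<lambda>\<omega>. F \<omega> x $ k) \<in> borel_measurable M"
  shows "(\<lambda>\<omega>. lipschitz_const d (F \<omega>)) \<in> borel_measurable M"
proof (rule borel_measurableI_le)
  fix c :: real
  let ?Q = "({..<d} \<rightarrow>\<^sub>E \<rat>) \<times> ({..<d} \<rightarrow>\<^sub>E \<rat>) :: ((nat \<Rightarrow> real) \<times> (nat \<Rightarrow> real)) set"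
  let ?ineq = "\<lambda>\<omega> (p, q). vec_norm2 (F \<omega> (vec d p) - F \<omega> (vec d q)) \<le> c * vec_norm2 (vec d p - vec d q)"
  have "{\<omega> \<in> space M. lipschitz_const d (F \<omega>) \<le> c} = {\<omega> \<in> space M. 0 \<le> c \<and> (\<forall>\<tau>\<in>?Q. ?ineq \<omega> \<tau>)}"
  proof (rule Collect_cong, rule conj_cong[OF refl])
    fix \<omega> assume \<omega>: "\<omega> \<in> space M"
    show "lipschitz_const d (F \<omega>) \<le> c \<longleftrightarrow> 0 \<le> c \<and> (\<forall>\<tau>\<in>?Q. ?ineq \<omega> \<tau>)"
      by (rule lipschitz_const_le_iff_rational[OF lipschitz[OF \<omega>] K[OF \<omega>] carrier[OF \<omega>]])
  qed
  also have "\<dots> \<in> sets M"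
  proof (rule sets.sets_Collect_conj[OF sets.sets_Collect_countable_All' sets.sets_Collect_const])
    show "countable ?Q"
      by (intro countable_SIGMA countable_PiE finite_lessThan countable_rat)
    show "{\<omega> \<in> space M. ?ineq \<omega> \<tau>} \<in> sets M" for \<tau>
    proof -
      obtain p q where \<tau>: "\<tau> = (p, q)" by fastforce
      have "(\<lambda>\<omega>. \<Sum>k<e. (F \<omega> (vec d p) $ k - F \<omega> (vec d q) $ k)\<^sup>2) \<in> borel_measurable M"
        by (intro borel_measurable_sum borel_measurable_power borel_measurable_diff meas) auto
      then have "(\<lambda>\<omega>. L2_set (\<lambda>k. F \<omega> (vec d p) $ k - F \<omega> (vec d q) $ k) {..<e}) \<in> borel_measurable M"
        unfolding L2_set_def by measurable
      also have "?this \<longleftrightarrow> (\<lambda>\<omega>. vec_norm2 (F \<omega> (vec d p) - F \<omega> (vec d q))) \<in> borel_measurable M"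
        by (rule measurable_cong, rule vec_norm2_diff[symmetric]) (simp_all add: carrier)
      finally show ?thesis unfolding \<tau> prod.case by measurable
    qed
  qed
  finally show "{\<omega> \<in> space M. lipschitz_const d (F \<omega>) \<le> c} \<in> sets M" .
qed

text \<open>Integrability is part of the claim because the Bochner integral of a non-integrable
  function is 0 by convention, which would make the bound empty.\<close>

theorem theorem1:
  fixes M :: "'a measure"
    and n :: nat
    and h :: "nat \<Rightarrow> nat"
    and \<sigma> :: "nat \<Rightarrow> real"
    and \<phi> :: "nat \<Rightarrow> real \<Rightarrow> real"
    and b :: "nat \<Rightarrow> rvec"
    and \<theta> :: "nat \<Rightarrow> 'a \<Rightarrow> rmat"
  assumes "prob_space M"
    and "n \<ge> 1"
    and "\<And>j. j \<le> n \<Longrightarrow> h j > 0"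
    and "\<And>j. j \<in> {1..n} \<Longrightarrow> \<sigma> j \<ge> 0"
    and "\<And>j. j \<in> {1..n} \<Longrightarrow> 1-lipschitz_on UNIV (\<phi> j)"
    and "\<And>j. j \<in> {1..n} \<Longrightarrow> b j \<in> carrier_vec (h j)"
    and "\<And>j \<omega>. j \<in> {1..n} \<Longrightarrow> \<omega> \<in> space M \<Longrightarrow> \<theta> j \<omega> \<in> carrier_mat (h (j - 1)) (h j)"
    and "prob_space.indep_vars M (\<lambda>_. borel) (\<lambda>(j, i, k) \<omega>. index_mat (\<theta> j \<omega>) (i, k))
           (SIGMA j:{1..n}. {..<h (j - 1)} \<times> {..<h j})"
    and "\<And>j i k. j \<in> {1..n} \<Longrightarrow> i < h (j - 1) \<Longrightarrow> k < h j \<Longrightarrow>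
           gaussian_rv M (\<lambda>\<omega>. index_mat (\<theta> j \<omega>) (i, k)) 0 (\<sigma> j)"
  shows "integrable M (\<lambda>\<omega>. lipschitz_const (h 0) (network \<phi> (\<lambda>j. \<theta> j \<omega>) b n)) \<and>
         prob_space.expectation M (\<lambda>\<omega>. lipschitz_const (h 0) (network \<phi> (\<lambda>j. \<theta> j \<omega>) b n))
           \<le> (\<Prod>j=1..n. (sqrt (real (h (j - 1))) + sqrt (real (h j))) * \<sigma> j)"
proof -
  interpret prob_space M by fact
  define J where "J j = {..<h (j - 1)} \<times> {..<h j}" for j
  define I where "I = (SIGMA j:{1..n}. J j)"
  define X where "X = (\<lambda>(j, i, k) \<omega>. index_mat (\<theta> j \<omega>) (i, k))"
  define N where "N j \<omega> = operator_norm (h (j - 1)) (h j) (\<lambda>p. \<theta> j \<omega> $$ p)" for j \<omega>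
  \<comment> \<open>Forgets the layer index, turning a block of the whole family into a single
    matrix.\<close>
  define slice where "slice j z = (\<lambda>p\<in>J j. z (j, p))" for j and z :: "nat \<times> nat \<times> nat \<Rightarrow> real"
  let ?G = "\<lambda>j. gaussian_measure 0 (\<sigma> j)" and ?L = "\<lambda>\<omega>. lipschitz_const (h 0) (network \<phi> (\<lambda>j. \<theta> j \<omega>) b n)"
  have h: "h (j - 1) > 0" "h j > 0" if "j \<in> {1..n}" for j
    using assms(3)[of j] assms(3)[of "j - 1"] that by auto
  have indep: "indep_vars (\<lambda>_. borel) X I"
    using assms(8) by (simp add: I_def J_def X_def)
  have X_gauss: "X p \<in> borel_measurable M" "distr M borel (X p) = ?G (fst p)" if "p \<in> I" for p
    using assms(9)[of "fst p" "fst (snd p)" "snd (snd p)"] that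
    by (auto simp: gaussian_rv_def X_def I_def J_def)
  \<comment> \<open>Exhibits the norm of layer \<open>j\<close> as a function of its own block of
    entries.\<close>
  have N_eq: "N j \<omega> = operator_norm (h (j - 1)) (h j) (slice j (\<lambda>p\<in>{j} \<times> J j. X p \<omega>))" for j \<omega>
  proof -
    have "slice j (\<lambda>p\<in>{j} \<times> J j. X p \<omega>) = restrict (\<lambda>p. \<theta> j \<omega> $$ p) ({..<h (j - 1)} \<times> {..<h j})"
      unfolding slice_def J_def X_def by (rule restrict_ext) auto
    then show ?thesis by (simp add: N_def operator_norm_restrict)
  qed
  have slice_meas: "slice j \<in> measurable (PiM ({j} \<times> J j) (\<lambda>_. borel)) (PiM (J j) (\<lambda>_. borel))" for j
    unfolding slice_def by (rule measurable_restrict) (auto intro!: measurable_component_singleton)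
  have norm_meas: "operator_norm (h (j - 1)) (h j) \<in> borel_measurable (PiM (J j) (\<lambda>_. borel))" for j
    unfolding J_def by (rule operator_norm_measurable)
  have N_indep: "indep_vars (\<lambda>_. borel) N {1..n}"
  proof -
    \<comment> \<open>Disjoint blocks of an independent family are independent, and measurable
      functions of them remain so.\<close>
    have "indep_vars (\<lambda>j. PiM ({j} \<times> J j) (\<lambda>_. borel)) (\<lambda>j \<omega>. \<lambda>p\<in>{j} \<times> J j. X p \<omega>) {1..n}"
      by (rule indep_vars_restrict[OF indep]) (auto simp: I_def disjoint_family_on_def)
    then have "indep_vars (\<lambda>_. borel)
        (\<lambda>j \<omega>. operator_norm (h (j - 1)) (h j) (slice j (\<lambda>p\<in>{j} \<times> J j. X p \<omega>))) {1..n}"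
      by (rule indep_vars_compose2) (rule measurable_compose[OF slice_meas norm_meas])
    then show ?thesis by (simp add: N_eq[abs_def])
  qed
  have N_int: "integrable M (N j)"
    "(\<integral>\<omega>. N j \<omega> \<partial>M) \<le> (sqrt (h (j - 1)) + sqrt (h j)) * \<sigma> j" if j: "j \<in> {1..n}" for j
  proof -
    let ?K = "{j} \<times> J j"
    interpret PG: product_prob_space "\<lambda>_ :: nat \<times> nat \<times> nat. ?G j"
      by (rule product_prob_space_gaussian[OF assms(4)[OF j]])
    have K: "?K \<subseteq> I" "?K \<noteq> {}" "finite ?K"
      using j h[OF j] by (auto simp: I_def J_def)
    have X_rv: "X p \<in> borel_measurable M" if "p \<in> ?K" for p
      using X_gauss(1) K(1) that by blast
    have V_meas: "(\<lambda>\<omega>. \<lambda>p\<in>?K. X p \<omega>) \<in> measurable M (PiM ?K (\<lambda>_. borel))"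
      by (rule measurable_restrict) (rule X_rv)
    \<comment> \<open>By independence the joint law of the block is the product of the marginals,
      which all equal \<open>?G j\<close> within one layer.\<close>
    have "distr M (PiM ?K (\<lambda>_. borel)) (\<lambda>\<omega>. \<lambda>p\<in>?K. X p \<omega>) = PiM ?K (\<lambda>p. distr M borel (X p))"
      using indep_vars_iff_distr_eq_PiM'[OF K(2), where M' = "\<lambda>_. borel" and X = X] X_rv indep_vars_subset[OF indep K(1)]
      by blast
    also have "\<dots> = PiM ?K (\<lambda>_. ?G j)"
      using X_gauss(2) K(1) by (intro PiM_cong) auto
    finally have V: "distr M (PiM ?K (\<lambda>_. borel)) (\<lambda>\<omega>. \<lambda>p\<in>?K. X p \<omega>) = PiM ?K (\<lambda>_. ?G j)" .
    \<comment> \<open>Dropping the constant index \<open>j\<close> is a bijective renaming of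
      coordinates and preserves the product law.\<close>
    have sl: "distr (PiM ?K (\<lambda>_. ?G j)) (PiM (J j) (\<lambda>_. ?G j)) (slice j) = PiM (J j) (\<lambda>_. ?G j)"
      unfolding slice_def[abs_def] by (rule PG.distr_reorder) (use K in \<open>auto simp: inj_on_def\<close>)
    have sets_eq: "sets (PiM (J j) (\<lambda>_. ?G j)) = sets (PiM (J j) (\<lambda>_. borel))"
      by (intro sets_PiM_cong) auto
    have "distr M (PiM (J j) (\<lambda>_. borel)) (\<lambda>\<omega>. slice j (\<lambda>p\<in>?K. X p \<omega>)) =
        distr (PiM ?K (\<lambda>_. ?G j)) (PiM (J j) (\<lambda>_. borel)) (slice j)"
      unfolding V[symmetric] by (subst distr_distr[OF slice_meas V_meas]) (simp add: comp_def)
    also have "\<dots> = PiM (J j) (\<lambda>_. ?G j)"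
      by (subst sl[symmetric], rule distr_cong) (simp_all add: sets_eq)
    finally have D: "distr M (PiM (J j) (\<lambda>_. borel)) (\<lambda>\<omega>. slice j (\<lambda>p\<in>?K. X p \<omega>)) = PiM (J j) (\<lambda>_. ?G j)" .
    note SV_meas = measurable_compose[OF V_meas slice_meas]
    show "integrable M (N j)"
      using integrable_distr[OF SV_meas, of "operator_norm (h (j - 1)) (h j)"]
        operator_norm_expectation(1)[OF assms(4)[OF j] h[OF j]]
      unfolding D by (simp add: J_def N_eq[abs_def])
    show "(\<integral>\<omega>. N j \<omega> \<partial>M) \<le> (sqrt (h (j - 1)) + sqrt (h j)) * \<sigma> j"
      using integral_distr[OF SV_meas norm_meas] operator_norm_expectation(2)[OF assms(4)[OF j] h[OF j]]
      unfolding D by (simp add: J_def N_eq[abs_def])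
  qed
  have N_nonneg: "N j \<omega> \<ge> 0" if "j \<in> {1..n}" for j \<omega>
    unfolding N_def by (rule operator_norm_nonneg[OF h[OF that]])
  have lip: "vec_norm2 (network \<phi> (\<lambda>j. \<theta> j \<omega>) b n x - network \<phi> (\<lambda>j. \<theta> j \<omega>) b n x')
      \<le> (\<Prod>j=1..n. N j \<omega>) * vec_norm2 (x - x')"
    if "\<omega> \<in> space M" "x \<in> carrier_vec (h 0)" "x' \<in> carrier_vec (h 0)" for \<omega> x x'
    unfolding N_def using that assms by (intro network_lipschitz) auto
  have prod_nonneg: "(\<Prod>j=1..n. N j \<omega>) \<ge> 0" for \<omega>
    by (intro prod_nonneg ballI N_nonneg)
  have L_meas: "?L \<in> borel_measurable M"
  proof (rule lipschitz_const_measurable[OF lip prod_nonneg])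
    show "network \<phi> (\<lambda>j. \<theta> j \<omega>) b n x \<in> carrier_vec (h n)" if "\<omega> \<in> space M" "x \<in> carrier_vec (h 0)" for \<omega> x
      using that assms(6) by (intro network_carrier) auto
    show "(\<lambda>\<omega>. network \<phi> (\<lambda>j. \<theta> j \<omega>) b n x $ k) \<in> borel_measurable M"
      if "x \<in> carrier_vec (h 0)" "k < h n" for x k
      by (rule network_component_measurable[where h = h]) (use that assms in \<open>auto simp: gaussian_rv_def\<close>)
  qed
  have L_bounds: "0 \<le> ?L \<omega>" "?L \<omega> \<le> (\<Prod>j=1..n. N j \<omega>)" if "\<omega> \<in> space M" for \<omega>
    using lipschitz_const_nonneg[OF lip[OF that] prod_nonneg] lipschitz_const_le[OF lip[OF that] prod_nonneg]
    by auto
  have prod_int: "integrable M (\<lambda>\<omega>. \<Prod>j=1..n. N j \<omega>)"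
    by (rule indep_vars_integrable[OF _ N_indep N_int(1)]) auto
  have L_int: "integrable M ?L"
    by (rule Bochner_Integration.integrable_bound[OF prod_int L_meas])
       (use L_bounds prod_nonneg in \<open>auto intro!: AE_I2\<close>)
  have "expectation ?L \<le> expectation (\<lambda>\<omega>. \<Prod>j=1..n. N j \<omega>)"
    by (rule integral_mono[OF L_int prod_int L_bounds(2)])
  also have "\<dots> = (\<Prod>j=1..n. expectation (N j))"
    by (rule indep_vars_lebesgue_integral[OF _ N_indep N_int(1)]) auto
  also have "\<dots> \<le> (\<Prod>j=1..n. (sqrt (h (j - 1)) + sqrt (h j)) * \<sigma> j)"
    \<comment> \<open>Factorwise comparison of products requires the expected norms to be
      nonnegative.\<close>
    using N_int(2) N_nonneg by (intro prod_mono) (auto intro!: Bochner_Integration.integral_nonneg)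
  finally show ?thesis using L_int by simp
qed

end
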